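(* Let $G\subset \mathrm{SL}_3(\mathbb{C})$ be a finite subgroup, and let $\gamma$, $\gamma^*$, $\gamma_0,\dots,\gamma_l$, $B$, $B^*$, $v_m$, $P_G(t)$, $M(t)$, $M_0(t)$ be as in the context. Then: (a) for all integers $m\ge -1$ one has $v_{m+2}=Bv_{m+1}-B^*v_m+v_{m-1}$, where $v_{-1}=v_{-2}:=0$; (b) $P_G(t)$ satisfies the linear equation $\big((1-t^3)I-tB+t^2B^*\big)P_G(t)=v_0$ in $\mathbb{Z}[[t]]^{l+1}$, where $v_0=(1,0,\dots,0)^t$; (c) $\det M(t)$ is an invertible element of $\mathbb{Z}[[t]]$ and $$P_G(t)_0=\sum_{m\ge 0}\dim\big(S^m(\mathbb{C}^3)^G\big)\,t^m=\frac{\det M_0(t)}{\det M(t)}.$$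
   Context: Let $G\subset\mathrm{SL}_3(\mathbb{C})$ be a finite group, $\gamma$ its natural 3-dimensional representation on $\mathbb{C}^3$ and $\gamma^*$ the contragredient (dual) representation. Let $\gamma_0,\gamma_1,\dots,\gamma_l$ be the irreducible complex representations of $G$ up to isomorphism, with $\gamma_0$ the trivial representation. Define the $(l+1)\times(l+1)$ integer matrices $B=(b_{ij})$ and $B^*=(b^*_{ij})$ (indices $0,\dots,l$) by $\gamma_j\otimes\gamma=\bigoplus_i b_{ij}\gamma_i$ and $\gamma_j\otimes\gamma^*=\bigoplus_i b^*_{ij}\gamma_i$. For $m\ge0$ let $\rho_m$ be the representation of $G$ on the $m$-th symmetric power $S^m(\mathbb{C}^3)$ (homogeneous polynomials of degree $m$) induced by the natural action, decompose $\rho_m=\sum_{i=0}^l v_{mi}\gamma_i$, and set $v_m=(v_{m0},\dots,v_{ml})^t\in\mathbb{Z}^{l+1}$. Put $P_G(t)=\sum_{m\ge0}v_mt^m\in\mathbb{Z}[[t]]^{l+1}$ and $P_G(t)_0=\sum_{m\ge0}v_{m0}t^m$. Let $M(t)=(1-t^3)I-tB+t^2B^*$ (a matrix with entries in $\mathbb{Z}[t]$) and let $M_0(t)$ be the matrix obtained from $M(t)$ by replacing its first column (the column indexed by $\gamma_0$) with $(1,0,\dots,0)^t$. *)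

theory Defs
  imports "Jordan_Normal_Form.Matrix_Kernel" "Jordan_Normal_Form.Gauss_Jordan_Elimination"
    "Jordan_Normal_Form.Determinant" "HOL-Library.Poly_Mapping"
    "HOL-Computational_Algebra.Formal_Power_Series"
begin

definition finite_subgroup_SL3 :: "complex mat set \<Rightarrow> bool" where
  "finite_subgroup_SL3 G \<longleftrightarrow> finite G \<and> 1\<^sub>m 3 \<in> G \<and>
     (\<forall>g\<in>G. g \<in> carrier_mat 3 3 \<and> det g = 1) \<and>
     (\<forall>g\<in>G. \<forall>h\<in>G. g * h \<in> G) \<and>
     (\<forall>g\<in>G. \<exists>h\<in>G. g * h = 1\<^sub>m 3)"

definition is_rep :: "complex mat set \<Rightarrow> nat \<Rightarrow> (complex mat \<Rightarrow> complex mat) \<Rightarrow> bool" where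
  "is_rep G n \<rho> \<longleftrightarrow> (\<forall>g\<in>G. \<rho> g \<in> carrier_mat n n) \<and>
     (\<forall>g\<in>G. \<forall>h\<in>G. \<rho> (g * h) = \<rho> g * \<rho> h) \<and> \<rho> (1\<^sub>m 3) = 1\<^sub>m n"

definition rep_iso :: "complex mat set \<Rightarrow> nat \<Rightarrow> (complex mat \<Rightarrow> complex mat)
    \<Rightarrow> (complex mat \<Rightarrow> complex mat) \<Rightarrow> bool" where
  "rep_iso G n \<rho> \<sigma> \<longleftrightarrow> (\<exists>P \<in> carrier_mat n n. invertible_mat P \<and> (\<forall>g\<in>G. P * \<rho> g = \<sigma> g * P))"

definition inv_subspace :: "complex mat set \<Rightarrow> nat \<Rightarrow> (complex mat \<Rightarrow> complex mat)
    \<Rightarrow> complex vec set \<Rightarrow> bool" where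
  "inv_subspace G n \<rho> W \<longleftrightarrow> W \<subseteq> carrier_vec n \<and> 0\<^sub>v n \<in> W \<and>
     (\<forall>x\<in>W. \<forall>y\<in>W. x + y \<in> W) \<and> (\<forall>c. \<forall>x\<in>W. c \<cdot>\<^sub>v x \<in> W) \<and>
     (\<forall>g\<in>G. \<forall>x\<in>W. \<rho> g *\<^sub>v x \<in> W)"

definition irreducible_rep :: "complex mat set \<Rightarrow> nat \<Rightarrow> (complex mat \<Rightarrow> complex mat) \<Rightarrow> bool" where
  "irreducible_rep G n \<rho> \<longleftrightarrow> is_rep G n \<rho> \<and> 0 < n \<and>
     (\<forall>W. inv_subspace G n \<rho> W \<longrightarrow> W = {0\<^sub>v n} \<or> W = carrier_vec n)"

definition irr_list :: "complex mat set \<Rightarrow> nat \<Rightarrow> (nat \<Rightarrow> nat)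
    \<Rightarrow> (nat \<Rightarrow> complex mat \<Rightarrow> complex mat) \<Rightarrow> bool" where
  "irr_list G l d gam \<longleftrightarrow>
     (\<forall>i\<le>l. irreducible_rep G (d i) (gam i)) \<and>
     (\<forall>i\<le>l. \<forall>j\<le>l. i \<noteq> j \<longrightarrow> \<not> (d i = d j \<and> rep_iso G (d i) (gam i) (gam j))) \<and>
     (\<forall>n \<rho>. irreducible_rep G n \<rho> \<longrightarrow> (\<exists>i\<le>l. d i = n \<and> rep_iso G n \<rho> (gam i))) \<and>
     d 0 = 1 \<and> rep_iso G 1 (gam 0) (\<lambda>_. 1\<^sub>m 1)"

definition dsum_rep :: "nat \<Rightarrow> (nat \<Rightarrow> complex mat \<Rightarrow> complex mat) \<Rightarrow> (nat \<Rightarrow> nat)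
    \<Rightarrow> complex mat \<Rightarrow> complex mat" where
  "dsum_rep l gam c g = diag_block_mat (concat (map (\<lambda>i. replicate (c i) (gam i g)) [0..<Suc l]))"

definition decomposes :: "complex mat set \<Rightarrow> nat \<Rightarrow> (complex mat \<Rightarrow> complex mat) \<Rightarrow> nat
    \<Rightarrow> (nat \<Rightarrow> nat) \<Rightarrow> (nat \<Rightarrow> complex mat \<Rightarrow> complex mat) \<Rightarrow> (nat \<Rightarrow> nat) \<Rightarrow> bool" where
  "decomposes G n \<rho> l d gam c \<longleftrightarrow> n = (\<Sum>i\<le>l. c i * d i) \<and> rep_iso G n \<rho> (dsum_rep l gam c)"

definition kron :: "complex mat \<Rightarrow> complex mat \<Rightarrow> complex mat" where
  "kron A B = mat (dim_row A * dim_row B) (dim_col A * dim_col B)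
     (\<lambda>(i, j). A $$ (i div dim_row B, j div dim_col B) * B $$ (i mod dim_row B, j mod dim_col B))"

definition dual3 :: "complex mat \<Rightarrow> complex mat" where
  "dual3 g = transpose_mat (the (mat_inverse g))"

type_synonym cpoly = "(nat \<Rightarrow>\<^sub>0 nat) \<Rightarrow>\<^sub>0 complex"

text \<open>Exponent triples (a,b,c) with a+b+c = m: the monomial basis of S^m(C^3).\<close>
definition mons :: "nat \<Rightarrow> (nat \<times> nat \<times> nat) list" where
  "mons m = concat (map (\<lambda>a. map (\<lambda>b. (a, b, m - a - b)) [0..<Suc m - a]) [0..<Suc m])"

definition mon_key :: "nat \<times> nat \<times> nat \<Rightarrow> (nat \<Rightarrow>\<^sub>0 nat)" where
  "mon_key e = (case e of (a, b, c) \<Rightarrow>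
     Poly_Mapping.single 0 a + Poly_Mapping.single 1 b + Poly_Mapping.single 2 c)"

text \<open>Image of the basis vector e_j under g:  sum_i g_{ij} x_i  (x_i = e_i).\<close>
definition lin_form :: "complex mat \<Rightarrow> nat \<Rightarrow> cpoly" where
  "lin_form g j = (\<Sum>i<3. Poly_Mapping.single (Poly_Mapping.single i 1) (g $$ (i, j)))"

definition mon_image :: "complex mat \<Rightarrow> nat \<times> nat \<times> nat \<Rightarrow> cpoly" where
  "mon_image g e = (case e of (a, b, c) \<Rightarrow> lin_form g 0 ^ a * lin_form g 1 ^ b * lin_form g 2 ^ c)"

definition sym_dim :: "nat \<Rightarrow> nat" where
  "sym_dim m = length (mons m)"

definition sym_rep :: "nat \<Rightarrow> complex mat \<Rightarrow> complex mat" where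
  "sym_rep m g = mat (sym_dim m) (sym_dim m)
     (\<lambda>(r, s). Poly_Mapping.lookup (mon_image g (mons m ! s)) (mon_key (mons m ! r)))"

definition invariants :: "complex mat set \<Rightarrow> nat \<Rightarrow> (complex mat \<Rightarrow> complex mat) \<Rightarrow> complex vec set" where
  "invariants G n \<rho> = {x \<in> carrier_vec n. \<forall>g\<in>G. \<rho> g *\<^sub>v x = x}"

definition inv_dim :: "complex mat set \<Rightarrow> nat \<Rightarrow> (complex mat \<Rightarrow> complex mat) \<Rightarrow> nat" where
  "inv_dim G n \<rho> = vectorspace.dim class_ring
     ((module_vec TYPE(complex) n)\<lparr>carrier := invariants G n \<rho>\<rparr>)"

definition Mt :: "(nat \<Rightarrow> nat \<Rightarrow> nat) \<Rightarrow> (nat \<Rightarrow> nat \<Rightarrow> nat) \<Rightarrow> nat \<Rightarrow> nat \<Rightarrow> int fps" where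
  "Mt B Bs i j = (if i = j then 1 - fps_X ^ 3 else 0)
      - fps_X * of_nat (B i j) + fps_X ^ 2 * of_nat (Bs i j)"

definition M_mat :: "nat \<Rightarrow> (nat \<Rightarrow> nat \<Rightarrow> nat) \<Rightarrow> (nat \<Rightarrow> nat \<Rightarrow> nat) \<Rightarrow> int fps mat" where
  "M_mat l B Bs = mat (Suc l) (Suc l) (\<lambda>(i, j). Mt B Bs i j)"

definition M0_mat :: "nat \<Rightarrow> (nat \<Rightarrow> nat \<Rightarrow> nat) \<Rightarrow> (nat \<Rightarrow> nat \<Rightarrow> nat) \<Rightarrow> int fps mat" where
  "M0_mat l B Bs = mat (Suc l) (Suc l)
     (\<lambda>(i, j). if j = 0 then (if i = 0 then 1 else 0) else Mt B Bs i j)"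

definition PG :: "(nat \<Rightarrow> nat \<Rightarrow> nat) \<Rightarrow> nat \<Rightarrow> int fps" where
  "PG v i = Abs_fps (\<lambda>m. int (v m i))"

definition vext :: "(nat \<Rightarrow> nat \<Rightarrow> nat) \<Rightarrow> int \<Rightarrow> nat \<Rightarrow> int" where
  "vext v k i = (if k < 0 then 0 else int (v (nat k) i))"

end

theory Submission
  imports Defs "Jordan_Normal_Form.Spectral_Radius" "Jordan_Normal_Form.Schur_Decomposition"
begin

text \<open>
  Evaluating characters at \<open>g \<in> G\<close> turns the claim into an identity of complex power series.
  If \<open>g\<close> has eigenvalues \<open>a, b, c\<close> with \<open>a b c = 1\<close>, then \<open>tr (S\<^sup>m g)\<close> is the complete homogeneous
  symmetric polynomial of degree \<open>m\<close> in \<open>a, b, c\<close>, whose generating function is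
  \<open>1 / ((1 - a t) (1 - b t) (1 - c t)) = 1 / (1 - tr g t + tr g\<^sup>-\<^sup>1 t\<^sup>2 - t\<^sup>3)\<close>.
  Since the vector of irreducible characters at \<open>g\<close> is a left eigenvector of \<open>B\<close> and \<open>B\<^sup>*\<close> with
  eigenvalues \<open>tr g\<close> and \<open>tr g\<^sup>-\<^sup>1\<close>, pairing it with both sides of (b) gives \<open>1 = 1\<close>; linear independence
  of the irreducible characters then yields (b). Part (a) is the comparison of coefficients in (b), and
  (c) is Cramer's rule together with \<open>M(0) = I\<close> and the fact that the dimension of the invariants is
  the trace of the averaging idempotent.
\<close>

subsection \<open>Traces\<close>

definition mtrace :: "complex mat \<Rightarrow> complex" where
  "mtrace A = (\<Sum>i<dim_row A. A $$ (i, i))"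

lemma mult_mat_entry:
  assumes "A \<in> carrier_mat n m" "B \<in> carrier_mat m k" "i < n" "j < k"
  shows "(A * B) $$ (i, j) = (\<Sum>p<m. A $$ (i, p) * B $$ (p, j))"
  using assms by (simp add: scalar_prod_def atLeast0LessThan)

lemma mult_unit_vec_index:
  assumes "(A :: complex mat) \<in> carrier_mat m n" "i < m" "j < n"
  shows "(A *\<^sub>v unit_vec n j) $ i = A $$ (i, j)"
  using assms scalar_prod_right_unit[of j n "row A i"] by auto

lemma mtrace_mult_commute:
  assumes A: "A \<in> carrier_mat n m" and B: "B \<in> carrier_mat m n"
  shows "mtrace (A * B) = mtrace (B * A)"
proof -
  have "mtrace (A * B) = (\<Sum>i<n. \<Sum>p<m. A $$ (i, p) * B $$ (p, i))"
    using A B by (simp add: mtrace_def mult_mat_entry[OF A B] del: index_mult_mat(1))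
  also have "\<dots> = (\<Sum>p<m. \<Sum>i<n. B $$ (p, i) * A $$ (i, p))"
    by (subst sum.swap) (simp add: mult.commute)
  also have "\<dots> = mtrace (B * A)"
    using A B by (simp add: mtrace_def mult_mat_entry[OF B A] del: index_mult_mat(1))
  finally show ?thesis .
qed

lemma mtrace_one [simp]: "mtrace (1\<^sub>m n) = of_nat n"
  by (simp add: mtrace_def)

lemma invertible_matE:
  assumes "invertible_mat P" "P \<in> carrier_mat n n"
  obtains Q where "Q \<in> carrier_mat n n" "P * Q = 1\<^sub>m n" "Q * P = 1\<^sub>m n"
proof -
  obtain Q where Q: "P * Q = 1\<^sub>m (dim_row P)" "Q * P = 1\<^sub>m (dim_row Q)"
    using assms(1) by (auto simp: invertible_mat_def inverts_mat_def)
  have "dim_col (P * Q) = n" using Q(1) assms(2) by simp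
  moreover have "dim_col (Q * P) = dim_row Q" using Q(2) by simp
  ultimately have "Q \<in> carrier_mat n n" using assms(2) by auto
  then show ?thesis using that Q assms(2) by auto
qed

text \<open>Cyclicity of the trace: with \<open>Q\<close> inverse to \<open>P\<close>, tr (Q (P
  \<rho>)) = tr ((P \<rho>) Q), and intertwining turns the right side into the trace of
  \<open>\<sigma> g\<close>.\<close>

lemma rep_iso_mtrace:
  assumes iso: "rep_iso G n \<rho> \<sigma>" and g: "g \<in> G"
    and r: "\<rho> g \<in> carrier_mat n n" and s: "\<sigma> g \<in> carrier_mat n n"
  shows "mtrace (\<rho> g) = mtrace (\<sigma> g)"
proof -
  obtain P where P: "P \<in> carrier_mat n n" "invertible_mat P" "P * \<rho> g = \<sigma> g * P"
    using iso g by (auto simp: rep_iso_def)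
  obtain Q where Q: "Q \<in> carrier_mat n n" "P * Q = 1\<^sub>m n" "Q * P = 1\<^sub>m n"
    using invertible_matE P by metis
  have "mtrace (\<rho> g) = mtrace (Q * (P * \<rho> g))"
    using assoc_mult_mat[OF Q(1) P(1) r] Q(3) r by simp
  also have "\<dots> = mtrace ((P * \<rho> g) * Q)"
    using Q mult_carrier_mat[OF s P(1)] P(3) by (intro mtrace_mult_commute[of _ n n]) auto
  also have "(P * \<rho> g) * Q = \<sigma> g"
    using assoc_mult_mat[OF s P(1) Q(1)] P(3) Q(2) s by simp
  finally show ?thesis .
qed

text \<open>The case split is the shape of the diagonal of a block matrix whose first block has size
  \<open>a\<close>.\<close>

lemma sum_lessThan_add_if:
  fixes f g :: "nat \<Rightarrow> 'a::comm_monoid_add"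
  shows "(\<Sum>i<a + b. if i < a then f i else g (i - a)) = (\<Sum>i<a. f i) + (\<Sum>i<b. g i)"
  by (induction b) (auto simp: add.assoc intro!: sum.cong)

lemma mtrace_diag_block_mat:
  assumes "\<forall>A\<in>set As. dim_row A = dim_col A"
  shows "mtrace (diag_block_mat As) = (\<Sum>A\<leftarrow>As. mtrace A)"
  using assms
proof (induction As)
  case Nil
  then show ?case by (simp add: mtrace_def)
next
  case (Cons A As)
  let ?B = "diag_block_mat As"
  have sq: "dim_row ?B = dim_col ?B"
    using Cons.prems by (simp add: dim_diag_block_mat) (metis map_eq_conv)
  have "mtrace (diag_block_mat (A # As)) =
      (\<Sum>i<dim_row A + dim_row ?B. if i < dim_row A then A $$ (i, i) else ?B $$ (i - dim_row A, i - dim_row A))"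
    using Cons.prems sq by (auto simp: mtrace_def Let_def intro!: sum.cong)
  also have "\<dots> = (\<Sum>i<dim_row A. A $$ (i, i)) + (\<Sum>i<dim_row ?B. ?B $$ (i, i))"
    by (rule sum_lessThan_add_if)
  also have "\<dots> = mtrace A + mtrace ?B" by (simp add: mtrace_def)
  finally show ?case using Cons by simp
qed

lemma mtrace_dsum_rep:
  assumes "\<And>i. i \<le> l \<Longrightarrow> gam i g \<in> carrier_mat (d i) (d i)"
  shows "dsum_rep l gam c g \<in> carrier_mat (\<Sum>i\<le>l. c i * d i) (\<Sum>i\<le>l. c i * d i)"
    and "mtrace (dsum_rep l gam c g) = (\<Sum>i\<le>l. of_nat (c i) * mtrace (gam i g))"
proof -
  \<comment> \<open>The function \<open>f\<close> is kept generic because the same identity is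
    needed twice: for block sizes in \<open>nat\<close> and for complex traces.\<close>
  have concat: "(\<Sum>A\<leftarrow>concat (map (\<lambda>i. replicate (c i) (gam i g)) [0..<Suc l]). f A)
      = (\<Sum>i\<le>l. of_nat (c i) * f (gam i g))" for f :: "complex mat \<Rightarrow> 'b::comm_semiring_1"
  proof -
    have "(\<Sum>A\<leftarrow>concat (map (\<lambda>i. replicate (c i) (gam i g)) [0..<n]). f A) = (\<Sum>i<n. of_nat (c i) * f (gam i g))" for n
      by (induction n) (auto simp: sum_list_replicate)
    then show ?thesis by (simp only: lessThan_Suc_atMost)
  qed
  let ?As = "concat (map (\<lambda>i. replicate (c i) (gam i g)) [0..<Suc l])"
  have dims: "dim_row (diag_block_mat ?As) = (\<Sum>i\<le>l. c i * d i)" "dim_col (diag_block_mat ?As) = (\<Sum>i\<le>l. c i * d i)"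
    using assms by (auto simp: dim_diag_block_mat concat carrier_matD[OF assms] simp del: upt_Suc intro!: sum.cong)
  then show "dsum_rep l gam c g \<in> carrier_mat (\<Sum>i\<le>l. c i * d i) (\<Sum>i\<le>l. c i * d i)"
    unfolding dsum_rep_def by auto
  have sq: "\<forall>A\<in>set ?As. dim_row A = dim_col A"
    using assms by (fastforce simp: less_Suc_eq_le simp del: upt_Suc)
  show "mtrace (dsum_rep l gam c g) = (\<Sum>i\<le>l. of_nat (c i) * mtrace (gam i g))"
    unfolding dsum_rep_def mtrace_diag_block_mat[OF sq] concat by simp
qed

lemma mtrace_kron:
  assumes A: "A \<in> carrier_mat n n" and B: "B \<in> carrier_mat k k"
  shows "mtrace (kron A B) = mtrace A * mtrace B"
proof (cases "k = 0")
  case True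
  then show ?thesis using assms by (simp add: mtrace_def kron_def)
next
  case False
  have "mtrace (kron A B) = (\<Sum>i<n * k. A $$ (i div k, i div k) * B $$ (i mod k, i mod k))"
    using assms by (simp add: mtrace_def kron_def)
  \<comment> \<open>The index range is cut into \<open>n\<close> blocks of length \<open>k\<close>;
    on block \<open>m\<close> the quotient is constantly \<open>m\<close> and the remainder runs
    through all residues.\<close>
  also have "\<dots> = (\<Sum>m<n. \<Sum>i = m * k..<m * k + k. A $$ (i div k, i div k) * B $$ (i mod k, i mod k))"
    by (rule sum.nat_group[symmetric])
  also have "\<dots> = (\<Sum>m<n. \<Sum>i<k. A $$ (m, m) * B $$ (i, i))"
  proof (rule sum.cong[OF refl])
    fix m
    have "(\<Sum>i = m * k..<m * k + k. A $$ (i div k, i div k) * B $$ (i mod k, i mod k))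
        = (\<Sum>i = 0..<k. A $$ ((i + m * k) div k, (i + m * k) div k) * B $$ ((i + m * k) mod k, (i + m * k) mod k))"
      using sum.shift_bounds_nat_ivl[of _ 0 "m * k" k] by (simp only: add_0 add.commute[of k])
    also have "\<dots> = (\<Sum>i<k. A $$ (m, m) * B $$ (i, i))"
      using False by (auto simp: atLeast0LessThan intro!: sum.cong)
    finally show "(\<Sum>i = m * k..<m * k + k. A $$ (i div k, i div k) * B $$ (i mod k, i mod k))
        = (\<Sum>i<k. A $$ (m, m) * B $$ (i, i))" .
  qed
  also have "\<dots> = mtrace A * mtrace B"
    using assms by (simp add: mtrace_def sum_product)
  finally show ?thesis .
qed

subsection \<open>Schur's lemma and orthogonality of characters\<close>

text \<open>Surjectivity produces a right inverse \<open>C\<close> column by column. Since A (C A -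
  1) = 0, injectivity makes \<open>C\<close> a left inverse too. The traces of A C and C A agree,
  which forces \<open>m = n\<close>.\<close>

lemma injective_surjective_mat_square:
  assumes A: "(A :: complex mat) \<in> carrier_mat m n"
    and inj: "\<And>x. x \<in> carrier_vec n \<Longrightarrow> A *\<^sub>v x = 0\<^sub>v m \<Longrightarrow> x = 0\<^sub>v n"
    and surj: "\<And>y. y \<in> carrier_vec m \<Longrightarrow> \<exists>x\<in>carrier_vec n. A *\<^sub>v x = y"
  shows "m = n \<and> invertible_mat A"
proof -
  have "\<exists>x. x \<in> carrier_vec n \<and> A *\<^sub>v x = unit_vec m j" for j
    using surj[of "unit_vec m j"] by auto
  then obtain c where c: "\<And>j. c j \<in> carrier_vec n \<and> A *\<^sub>v c j = unit_vec m j"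
    by metis
  define C where "C = mat_of_cols n (map c [0..<m])"
  have C: "C \<in> carrier_mat n m" using mat_of_cols_carrier(1)[of n "map c [0..<m]"] by (simp add: C_def)
  have colC: "col C j = c j" if "j < m" for j
    using that c by (simp add: C_def)
  have AC: "A * C = 1\<^sub>m m"
  proof (rule mat_col_eqI)
    fix j assume "j < dim_col (1\<^sub>m m)"
    then have j: "j < m" by simp
    have "col (A * C) j = unit_vec m j"
      unfolding col_mult2[OF A C j] colC[OF j] using c[of j] by (rule conjunct2)
    then show "col (A * C) j = col (1\<^sub>m m) j" using j by simp
  qed (use A C in auto)
  have CA: "C * A = 1\<^sub>m n"
  proof (rule mat_col_eqI)
    fix j assume j: "j < dim_col (1\<^sub>m n)"
    let ?u = "unit_vec n j"
    have jn: "j < n" using j by simp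
    have u: "?u \<in> carrier_vec n" by simp
    have "A *\<^sub>v ((C * A) *\<^sub>v ?u) = (A * (C * A)) *\<^sub>v ?u"
      using A C by (intro assoc_mult_mat_vec[symmetric]) auto
    also have "A * (C * A) = A" using assoc_mult_mat[OF A C A] AC A by simp
    finally have e: "A *\<^sub>v ((C * A) *\<^sub>v ?u) = A *\<^sub>v ?u" .
    have "A *\<^sub>v ((C * A) *\<^sub>v ?u - ?u) = A *\<^sub>v ((C * A) *\<^sub>v ?u) - A *\<^sub>v ?u"
      using A C by (intro mult_minus_distrib_mat_vec) auto
    also have "\<dots> = 0\<^sub>v m" unfolding e using A by auto
    finally have "(C * A) *\<^sub>v ?u - ?u = 0\<^sub>v n" using A C by (intro inj) auto
    then have z: "((C * A) *\<^sub>v ?u - ?u) $ i = 0" if "i < n" for i using that by simp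
    have Cu: "(C * A) *\<^sub>v ?u = ?u"
    proof (rule eq_vecI)
      fix i assume "i < dim_vec ?u"
      then have i: "i < dim_vec ?u" "i < n" by simp_all
      from z[OF i(2)] index_minus_vec(1)[OF i(1), of "(C * A) *\<^sub>v ?u"]
      show "((C * A) *\<^sub>v ?u) $ i = ?u $ i" by (simp only: right_minus_eq)
    qed (use C in simp)
    have "(C * A) *\<^sub>v ?u = col (C * A) j"
    proof (rule eq_vecI)
      fix i assume "i < dim_vec (col (C * A) j)"
      then have "i < n" using C by simp
      then have "((C * A) *\<^sub>v ?u) $ i = (C * A) $$ (i, j)"
        using A C jn by (intro mult_unit_vec_index[of _ n n]) auto
      also have "\<dots> = col (C * A) j $ i" using \<open>i < n\<close> A C jn by (intro index_col[symmetric]) auto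
      finally show "((C * A) *\<^sub>v ?u) $ i = col (C * A) j $ i" .
    qed (use C in simp)
    then show "col (C * A) j = col (1\<^sub>m n) j" unfolding Cu using jn by simp
  qed (use A C in auto)
  have "of_nat m = (of_nat n :: complex)"
    using mtrace_mult_commute[OF A C] AC CA by simp
  then have "m = n" by simp
  then show ?thesis
    using A C AC CA by (auto simp: invertible_mat_def inverts_mat_def)
qed

text \<open>Schur's lemma: the kernel and the image of an intertwiner are invariant subspaces. As
  \<open>A\<close> is nonzero, irreducibility leaves only kernel zero and full image.\<close>

lemma schur_intertwiner:
  assumes r: "irreducible_rep G n \<rho>" and s: "irreducible_rep G m \<sigma>"
    and A: "A \<in> carrier_mat m n" and comm: "\<And>g. g \<in> G \<Longrightarrow> A * \<rho> g = \<sigma> g * A"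
    and nz: "A \<noteq> 0\<^sub>m m n"
  shows "m = n \<and> rep_iso G n \<rho> \<sigma>"
proof -
  have rc: "\<rho> g \<in> carrier_mat n n" and sc: "\<sigma> g \<in> carrier_mat m m" if "g \<in> G" for g
    using r s that by (auto simp: irreducible_rep_def is_rep_def)
  have comm': "A *\<^sub>v (\<rho> g *\<^sub>v x) = \<sigma> g *\<^sub>v (A *\<^sub>v x)" if "g \<in> G" "x \<in> carrier_vec n" for g x
    using comm[OF that(1)] that A rc sc by (metis assoc_mult_mat_vec)
  let ?K = "{x \<in> carrier_vec n. A *\<^sub>v x = 0\<^sub>v m}"
  have "inv_subspace G n \<rho> ?K"
    unfolding inv_subspace_def
  proof (intro conjI ballI allI)
    fix g x assume "g \<in> G" "x \<in> ?K"
    then show "\<rho> g *\<^sub>v x \<in> ?K" using rc[of g] sc[of g] comm'[of g x] by auto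
  qed (use A in \<open>auto simp: mult_add_distrib_mat_vec mult_mat_vec\<close>)
  then have K: "?K = {0\<^sub>v n} \<or> ?K = carrier_vec n"
    using r by (auto simp: irreducible_rep_def)
  have notall: "?K \<noteq> carrier_vec n"
  proof
    assume "?K = carrier_vec n"
    then have "A *\<^sub>v unit_vec n j = 0\<^sub>v m" for j by (metis (mono_tags, lifting) mem_Collect_eq unit_vec_carrier)
    then have "A $$ (i, j) = 0" if "i < m" "j < n" for i j
      using that A mult_unit_vec_index[OF A] by (metis index_zero_vec(1))
    then show False using nz A by (auto intro!: eq_matI)
  qed
  let ?I = "(\<lambda>x. A *\<^sub>v x) ` carrier_vec n"
  have "inv_subspace G m \<sigma> ?I"
    unfolding inv_subspace_def
  proof (intro conjI ballI allI)
    show "?I \<subseteq> carrier_vec m" using A by auto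
    show "0\<^sub>v m \<in> ?I" using A by (intro image_eqI[of _ _ "0\<^sub>v n"]) auto
    fix x y assume "x \<in> ?I" "y \<in> ?I"
    then obtain x' y' where "x' \<in> carrier_vec n" "y' \<in> carrier_vec n" "x = A *\<^sub>v x'" "y = A *\<^sub>v y'" by auto
    then show "x + y \<in> ?I" using A by (intro image_eqI[of _ _ "x' + y'"]) (auto simp: mult_add_distrib_mat_vec)
  next
    fix c x assume "x \<in> ?I"
    then obtain x' where "x' \<in> carrier_vec n" "x = A *\<^sub>v x'" by auto
    then show "c \<cdot>\<^sub>v x \<in> ?I" using A by (intro image_eqI[of _ _ "c \<cdot>\<^sub>v x'"]) (auto simp: mult_mat_vec)
  next
    fix g x assume g: "g \<in> G" and "x \<in> ?I"
    then obtain x' where "x' \<in> carrier_vec n" "x = A *\<^sub>v x'" by auto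
    then show "\<sigma> g *\<^sub>v x \<in> ?I" using A comm' g rc[OF g] by (intro image_eqI[of _ _ "\<rho> g *\<^sub>v x'"]) auto
  qed
  then have I: "?I = {0\<^sub>v m} \<or> ?I = carrier_vec m"
    using s by (auto simp: irreducible_rep_def)
  have "?I \<noteq> {0\<^sub>v m}" using notall by auto
  with I have I: "?I = carrier_vec m" by blast
  have "m = n \<and> invertible_mat A"
  proof (rule injective_surjective_mat_square[OF A])
    show "\<And>x. x \<in> carrier_vec n \<Longrightarrow> A *\<^sub>v x = 0\<^sub>v m \<Longrightarrow> x = 0\<^sub>v n" using K notall by auto
    fix y :: "complex vec" assume "y \<in> carrier_vec m"
    then have "y \<in> ?I" by (simp only: I)
    then show "\<exists>x\<in>carrier_vec n. A *\<^sub>v x = y" by auto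
  qed
  then show ?thesis using A comm by (auto simp: rep_iso_def)
qed

text \<open>Over \<complex> the matrix \<open>A\<close> has an eigenvalue \<open>c\<close>; its
  eigenspace is invariant and nonzero, hence the whole space.\<close>

lemma schur_scalar:
  assumes r: "irreducible_rep G n \<rho>" and A: "A \<in> carrier_mat n n"
    and comm: "\<And>g. g \<in> G \<Longrightarrow> A * \<rho> g = \<rho> g * A"
  obtains c where "A = c \<cdot>\<^sub>m 1\<^sub>m n"
proof -
  have rc: "\<rho> g \<in> carrier_mat n n" if "g \<in> G" for g
    using r that by (auto simp: irreducible_rep_def is_rep_def)
  have "n > 0" using r by (simp add: irreducible_rep_def)
  then obtain c where "c \<in> spectrum A" using spectrum_non_empty[OF A] by auto
  then obtain w where "eigenvector A w c" by (auto simp: spectrum_def eigenvalue_def)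
  then have w: "w \<in> carrier_vec n" "w \<noteq> 0\<^sub>v n" "A *\<^sub>v w = c \<cdot>\<^sub>v w"
    using A by (auto simp: eigenvector_def)
  let ?K = "{x \<in> carrier_vec n. A *\<^sub>v x = c \<cdot>\<^sub>v x}"
  have "inv_subspace G n \<rho> ?K"
    unfolding inv_subspace_def
  proof (intro conjI ballI allI)
    fix g x assume g: "g \<in> G" and x: "x \<in> ?K"
    have "A *\<^sub>v (\<rho> g *\<^sub>v x) = \<rho> g *\<^sub>v (A *\<^sub>v x)"
      using comm[OF g] x A rc[OF g] by (metis (mono_tags, lifting) assoc_mult_mat_vec mem_Collect_eq)
    also have "\<dots> = c \<cdot>\<^sub>v (\<rho> g *\<^sub>v x)" using x rc[OF g] by (simp add: mult_mat_vec)
    finally show "\<rho> g *\<^sub>v x \<in> ?K" using x rc[OF g] by auto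
  qed (use A in \<open>auto simp: mult_add_distrib_mat_vec mult_mat_vec smult_add_distrib_vec smult_smult_assoc mult.commute\<close>)
  then have "?K = carrier_vec n" using r w by (auto simp: irreducible_rep_def)
  then have e: "A *\<^sub>v unit_vec n j = c \<cdot>\<^sub>v unit_vec n j" for j
    by (metis (mono_tags, lifting) mem_Collect_eq unit_vec_carrier)
  have "A $$ (i, j) = c * (if i = j then 1 else 0)" if "i < n" "j < n" for i j
  proof -
    have "A $$ (i, j) = (A *\<^sub>v unit_vec n j) $ i" using that mult_unit_vec_index[OF A] by simp
    also have "\<dots> = c * (if i = j then 1 else 0)" unfolding e using that by simp
    finally show ?thesis .
  qed
  then have "A = c \<cdot>\<^sub>m 1\<^sub>m n" using A by (auto intro!: eq_matI)
  then show ?thesis using that by blast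
qed

text \<open>The same matrix that \<open>dual3\<close> transposes, so the trace of
  \<open>dual3 g\<close> is that of \<open>ginv g\<close>.\<close>

definition ginv :: "complex mat \<Rightarrow> complex mat" where
  "ginv g = the (mat_inverse g)"

text \<open>The group axioms supply a right inverse \<open>h\<close>. For square matrices it is
  two-sided, so \<open>mat_inverse\<close> succeeds, and uniqueness of inverses identifies its
  result with \<open>h\<close>, an element of \<open>G\<close>.\<close>

lemma ginv:
  assumes G: "finite_subgroup_SL3 G" and g: "g \<in> G"
  shows "ginv g \<in> G" "g * ginv g = 1\<^sub>m 3" "ginv g * g = 1\<^sub>m 3"
proof -
  have gc: "g \<in> carrier_mat 3 3" using G g by (auto simp: finite_subgroup_SL3_def)
  obtain h where h: "h \<in> G" "g * h = 1\<^sub>m 3" using G g by (auto simp: finite_subgroup_SL3_def)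
  have hc: "h \<in> carrier_mat 3 3" using G h by (auto simp: finite_subgroup_SL3_def)
  have hg: "h * g = 1\<^sub>m 3" by (rule mat_mult_left_right_inverse[OF gc hc h(2)])
  have "g \<in> Units (ring_mat TYPE(complex) 3 ())"
    using gc hc h hg by (auto simp: Units_def ring_mat_def)
  then obtain B where B: "mat_inverse g = Some B"
    using mat_inverse(1)[OF gc, of "()"] by (cases "mat_inverse g") auto
  from mat_inverse(2)[OF gc B] have B': "g * B = 1\<^sub>m 3" "B * g = 1\<^sub>m 3" "B \<in> carrier_mat 3 3" by auto
  have "B = (h * g) * B" using B' hg by simp
  also have "\<dots> = h" using assoc_mult_mat[OF hc gc B'(3)] B' hc by simp
  finally show "ginv g \<in> G" "g * ginv g = 1\<^sub>m 3" "ginv g * g = 1\<^sub>m 3"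
    using B h hg by (auto simp: ginv_def)
qed

section \<open>Orthogonality relations for the characters of a fixed finite group\<close>

context
  fixes G assumes G: "finite_subgroup_SL3 G"
begin

lemma group_carrier: "g \<in> G \<Longrightarrow> g \<in> carrier_mat 3 3"
  and group_mult: "g \<in> G \<Longrightarrow> h \<in> G \<Longrightarrow> g * h \<in> G"
  and group_one: "1\<^sub>m 3 \<in> G"
  and group_finite: "finite G"
  using G by (auto simp: finite_subgroup_SL3_def)

lemma group_cancel:
  assumes "g \<in> G" "h \<in> G"
  shows "ginv h * (h * g) = g" "h * (ginv h * g) = g"
  using assms ginv[OF G, of h] group_carrier assoc_mult_mat[of h 3 3 "ginv h" 3 g 3]
    assoc_mult_mat[of "ginv h" 3 3 h 3 g 3] by (simp_all add: left_mult_one_mat[of g 3 3])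

lemma sum_group_translate:
  assumes "h \<in> G"
  shows "(\<Sum>g\<in>G. f (h * g)) = (\<Sum>g\<in>G. f g)"
  using assms group_cancel ginv[OF G] group_mult
  by (intro sum.reindex_bij_witness[of _ "\<lambda>g. ginv h * g" "\<lambda>g. h * g"]) auto

text \<open>This is the form in which the substitution of h g for g cancels a factor
  \<open>h\<close> to the right of the inverse.\<close>

lemma ginv_mult:
  assumes "g \<in> G" "h \<in> G"
  shows "ginv (h * g) * h = ginv g"
proof -
  note c = group_carrier[OF assms(1)] group_carrier[OF assms(2)]
    group_carrier[OF ginv(1)[OF G assms(1)]] group_carrier[OF ginv(1)[OF G group_mult[OF assms(2,1)]]]
  have "ginv (h * g) * h = ginv (h * g) * (h * (g * ginv g))"
    using ginv[OF G assms(1)] c by simp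
  also have "\<dots> = (ginv (h * g) * (h * g)) * ginv g"
    using c by (simp add: assoc_mult_mat[of _ 3 3 _ 3 _ 3])
  also have "\<dots> = ginv g" using ginv(3)[OF G group_mult[OF assms(2,1)]] c by simp
  finally show ?thesis .
qed

text \<open>In entries, the sum over g of \<sigma>(g) E \<rho>(g)^-1, where E is the matrix unit
  with its 1 at position (j, k).\<close>

definition avg_intertwiner where
  "avg_intertwiner m n \<sigma> \<rho> j k = mat m n (\<lambda>(i, q). \<Sum>g\<in>G. \<sigma> g $$ (i, j) * \<rho> (ginv g) $$ (k, q))"

lemma avg_intertwiner_comm:
  assumes r: "is_rep G n \<rho>" and s: "is_rep G m \<sigma>" and j: "j < m" and k: "k < n" and h: "h \<in> G"
  shows "avg_intertwiner m n \<sigma> \<rho> j k * \<rho> h = \<sigma> h * avg_intertwiner m n \<sigma> \<rho> j k" (is "?T * _ = _")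
proof -
  have rc: "\<rho> g \<in> carrier_mat n n" and sc: "\<sigma> g \<in> carrier_mat m m" if "g \<in> G" for g
    using r s that by (auto simp: is_rep_def)
  have rm: "\<rho> (g * g') = \<rho> g * \<rho> g'" and sm: "\<sigma> (g * g') = \<sigma> g * \<sigma> g'" if "g \<in> G" "g' \<in> G" for g g'
    using r s that by (auto simp: is_rep_def)
  have T: "?T \<in> carrier_mat m n" by (simp add: avg_intertwiner_def)
  show ?thesis
  proof (rule eq_matI)
    fix i q assume "i < dim_row (\<sigma> h * ?T)" "q < dim_col (\<sigma> h * ?T)"
    then have i: "i < m" and q: "q < n" using sc[OF h] T by auto
    have "(?T * \<rho> h) $$ (i, q) = (\<Sum>p<n. (\<Sum>g\<in>G. \<sigma> g $$ (i, j) * \<rho> (ginv g) $$ (k, p)) * \<rho> h $$ (p, q))"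
      using i by (simp add: mult_mat_entry[OF T rc[OF h] i q] del: index_mult_mat(1)) (simp add: avg_intertwiner_def)
    also have "\<dots> = (\<Sum>g\<in>G. \<sigma> g $$ (i, j) * (\<Sum>p<n. \<rho> (ginv g) $$ (k, p) * \<rho> h $$ (p, q)))"
      by (simp add: sum_distrib_left sum_distrib_right mult.assoc) (rule sum.swap)
    also have "\<dots> = (\<Sum>g\<in>G. \<sigma> g $$ (i, j) * \<rho> (ginv g * h) $$ (k, q))"
      using h by (intro sum.cong refl arg_cong2[of _ _ _ _ "(*)"])
        (simp add: rm ginv[OF G] mult_mat_entry[OF rc rc k q] del: index_mult_mat(1))
    \<comment> \<open>Translating the summation variable by \<open>h\<close> moves the factor
      \<open>h\<close> from the right of the average to its left.\<close>
    also have "\<dots> = (\<Sum>g\<in>G. \<sigma> (h * g) $$ (i, j) * \<rho> (ginv (h * g) * h) $$ (k, q))"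
      by (rule sum_group_translate[OF h, symmetric])
    also have "\<dots> = (\<Sum>g\<in>G. (\<Sum>p<m. \<sigma> h $$ (i, p) * \<sigma> g $$ (p, j)) * \<rho> (ginv g) $$ (k, q))"
      using h by (intro sum.cong refl)
        (simp add: sm ginv_mult mult_mat_entry[OF sc sc i j] del: index_mult_mat(1))
    also have "\<dots> = (\<Sum>p<m. \<sigma> h $$ (i, p) * (\<Sum>g\<in>G. \<sigma> g $$ (p, j) * \<rho> (ginv g) $$ (k, q)))"
      by (simp add: sum_distrib_left sum_distrib_right mult.assoc) (rule sum.swap)
    also have "\<dots> = (\<sigma> h * ?T) $$ (i, q)"
      using q by (simp add: mult_mat_entry[OF sc[OF h] T i q] del: index_mult_mat(1)) (simp add: avg_intertwiner_def)
    finally show "(?T * \<rho> h) $$ (i, q) = (\<sigma> h * ?T) $$ (i, q)" .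
  qed (use T rc[OF h] sc[OF h] in auto)
qed

text \<open>The product of two traces is a double sum of products of diagonal entries; each of
  these, summed over the group, is one entry of an averaged matrix unit.\<close>

lemma character_product_sum:
  assumes r: "is_rep G n \<rho>" and s: "is_rep G m \<sigma>"
  shows "(\<Sum>g\<in>G. mtrace (\<sigma> g) * mtrace (\<rho> (ginv g)))
    = (\<Sum>i<m. \<Sum>k<n. avg_intertwiner m n \<sigma> \<rho> i k $$ (i, k))"
proof -
  have rc: "dim_row (\<rho> g) = n" and sc: "dim_row (\<sigma> g) = m" if "g \<in> G" for g
    using r s that by (auto simp: is_rep_def)
  have "(\<Sum>g\<in>G. mtrace (\<sigma> g) * mtrace (\<rho> (ginv g)))
      = (\<Sum>g\<in>G. \<Sum>i<m. \<Sum>k<n. \<sigma> g $$ (i, i) * \<rho> (ginv g) $$ (k, k))"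
    by (intro sum.cong refl) (simp add: mtrace_def rc sc ginv[OF G] sum_product)
  also have "\<dots> = (\<Sum>i<m. \<Sum>g\<in>G. \<Sum>k<n. \<sigma> g $$ (i, i) * \<rho> (ginv g) $$ (k, k))"
    by (rule sum.swap)
  also have "\<dots> = (\<Sum>i<m. \<Sum>k<n. \<Sum>g\<in>G. \<sigma> g $$ (i, i) * \<rho> (ginv g) $$ (k, k))"
    by (intro sum.cong refl sum.swap)
  also have "\<dots> = (\<Sum>i<m. \<Sum>k<n. avg_intertwiner m n \<sigma> \<rho> i k $$ (i, k))"
    by (simp add: avg_intertwiner_def)
  finally show ?thesis .
qed

text \<open>By Schur's lemma every averaged matrix unit vanishes when the two representations are
  not isomorphic.\<close>

lemma character_orthogonal:
  assumes r: "irreducible_rep G n \<rho>" and s: "irreducible_rep G m \<sigma>"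
    and niso: "\<not> (n = m \<and> rep_iso G n \<rho> \<sigma>)"
  shows "(\<Sum>g\<in>G. mtrace (\<sigma> g) * mtrace (\<rho> (ginv g))) = 0"
proof -
  have rr: "is_rep G n \<rho>" "is_rep G m \<sigma>" using r s by (auto simp: irreducible_rep_def)
  have "avg_intertwiner m n \<sigma> \<rho> i k = 0\<^sub>m m n" if "i < m" "k < n" for i k
  proof (rule ccontr)
    assume "avg_intertwiner m n \<sigma> \<rho> i k \<noteq> 0\<^sub>m m n"
    then have "m = n \<and> rep_iso G n \<rho> \<sigma>"
      by (intro schur_intertwiner[OF r s _ avg_intertwiner_comm[OF rr that]]) (auto simp: avg_intertwiner_def)
    with niso show False by auto
  qed
  then show ?thesis by (simp add: character_product_sum[OF rr])
qed

text \<open>Each averaged matrix unit is a scalar matrix. Its trace is \<open>card G\<close> for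
  \<open>i = k\<close> and 0 otherwise, so the scalar is \<open>card G / n\<close> or 0, and the
  \<open>n\<close> pairs with \<open>i = k\<close> add up to \<open>card G\<close>.\<close>

lemma character_norm:
  assumes r: "irreducible_rep G n \<rho>"
  shows "(\<Sum>g\<in>G. mtrace (\<rho> g) * mtrace (\<rho> (ginv g))) = of_nat (card G)"
proof -
  have rr: "is_rep G n \<rho>" and n: "n > 0" using r by (auto simp: irreducible_rep_def)
  have rc: "\<rho> g \<in> carrier_mat n n" if "g \<in> G" for g
    using rr that by (auto simp: is_rep_def)
  have T: "avg_intertwiner n n \<rho> \<rho> i k $$ (i, k) = (if i = k then of_nat (card G) / of_nat n else 0)"
    if i: "i < n" and k: "k < n" for i k
  proof -
    let ?T = "avg_intertwiner n n \<rho> \<rho> i k"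
    obtain c where c: "?T = c \<cdot>\<^sub>m 1\<^sub>m n"
      using schur_scalar[OF r _ avg_intertwiner_comm[OF rr rr i k]] by (auto simp: avg_intertwiner_def)
    have "of_nat n * c = mtrace ?T" unfolding c by (simp add: mtrace_def)
    also have "\<dots> = (\<Sum>g\<in>G. \<Sum>q<n. \<rho> (ginv g) $$ (k, q) * \<rho> g $$ (q, i))"
      by (simp add: mtrace_def avg_intertwiner_def mult.commute) (rule sum.swap)
    also have "\<dots> = (\<Sum>g\<in>G. (\<rho> (ginv g) * \<rho> g) $$ (k, i))"
      by (intro sum.cong refl) (simp add: mult_mat_entry[OF rc rc k i] ginv[OF G] del: index_mult_mat(1))
    also have "\<dots> = (\<Sum>g\<in>G. (if k = i then 1 else 0))"
    proof (intro sum.cong refl)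
      fix g assume g: "g \<in> G"
      have "\<rho> (ginv g) * \<rho> g = \<rho> (ginv g * g)" using rr g ginv(1)[OF G g] by (auto simp: is_rep_def)
      also have "\<dots> = 1\<^sub>m n" using rr ginv[OF G g] by (simp add: is_rep_def)
      finally show "(\<rho> (ginv g) * \<rho> g) $$ (k, i) = (if k = i then 1 else 0)" using i k by simp
    qed
    finally have "of_nat n * c = (if k = i then of_nat (card G) else 0)" by simp
    then show ?thesis unfolding c using i k n by (auto simp: field_simps)
  qed
  show ?thesis using n by (simp add: character_product_sum[OF rr rr] T)
qed

text \<open>The coefficients are arbitrary complex numbers, so that this serves both linear
  independence of characters and the computation of the multiplicity of the trivial
  representation.\<close>

lemma irr_character_multiplicity:
  assumes irr: "irr_list G l d gam" and k: "k \<le> l"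
  shows "(\<Sum>g\<in>G. (\<Sum>i\<le>l. a i * mtrace (gam i g)) * mtrace (gam k (ginv g))) = a k * of_nat (card G)"
proof -
  have "(\<Sum>g\<in>G. (\<Sum>i\<le>l. a i * mtrace (gam i g)) * mtrace (gam k (ginv g)))
      = (\<Sum>i\<le>l. a i * (\<Sum>g\<in>G. mtrace (gam i g) * mtrace (gam k (ginv g))))"
    by (simp add: sum_distrib_left sum_distrib_right mult.assoc) (rule sum.swap)
  also have "\<dots> = (\<Sum>i\<le>l. if i = k then a k * of_nat (card G) else 0)"
  proof (intro sum.cong refl)
    fix i assume i: "i \<in> {..l}"
    have ir: "irreducible_rep G (d i) (gam i)" "irreducible_rep G (d k) (gam k)"
      using irr i k by (auto simp: irr_list_def)
    show "a i * (\<Sum>g\<in>G. mtrace (gam i g) * mtrace (gam k (ginv g)))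
        = (if i = k then a k * of_nat (card G) else 0)"
    proof (cases "i = k")
      case True
      then show ?thesis using character_norm[OF ir(1)] by simp
    next
      case False
      then have "\<not> (d k = d i \<and> rep_iso G (d k) (gam k) (gam i))"
        using irr i k by (auto simp: irr_list_def)
      then show ?thesis using character_orthogonal[OF ir(2,1)] False by simp
    qed
  qed
  also have "\<dots> = a k * of_nat (card G)" using k by simp
  finally show ?thesis .
qed

lemma irr_characters_independent:
  assumes irr: "irr_list G l d gam" and k: "k \<le> l"
    and "\<And>g. g \<in> G \<Longrightarrow> (\<Sum>i\<le>l. a i * mtrace (gam i g)) = 0"
  shows "a k = 0"
proof -
  have "a k * of_nat (card G) = 0"
    unfolding irr_character_multiplicity[OF irr k, symmetric] using assms(3) by simp
  moreover have "card G \<noteq> 0" using group_finite group_one by (auto simp: card_eq_0_iff)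
  ultimately show ?thesis by simp
qed

end

subsection \<open>Symmetric powers\<close>

definition pm_eval :: "('k \<Rightarrow> complex) \<Rightarrow> ('k \<Rightarrow>\<^sub>0 complex) \<Rightarrow> complex" where
  "pm_eval m p = (\<Sum>k\<in>Poly_Mapping.keys p. Poly_Mapping.lookup p k * m k)"

lemma pm_eval_superset:
  assumes "finite S" "Poly_Mapping.keys p \<subseteq> S"
  shows "pm_eval m p = (\<Sum>k\<in>S. Poly_Mapping.lookup p k * m k)"
  unfolding pm_eval_def using assms
  by (intro sum.mono_neutral_left) (auto simp: in_keys_iff)

lemma pm_eval_add: "pm_eval m (p + q) = pm_eval m p + pm_eval m q"
proof -
  let ?S = "Poly_Mapping.keys p \<union> Poly_Mapping.keys q"
  have "pm_eval m (p + q) = (\<Sum>k\<in>?S. Poly_Mapping.lookup (p + q) k * m k)"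
    by (rule pm_eval_superset) (auto simp: Poly_Mapping.keys_add)
  also have "\<dots> = (\<Sum>k\<in>?S. Poly_Mapping.lookup p k * m k) + (\<Sum>k\<in>?S. Poly_Mapping.lookup q k * m k)"
    by (simp add: lookup_add distrib_right sum.distrib)
  also have "\<dots> = pm_eval m p + pm_eval m q"
    by (simp add: pm_eval_superset[of ?S])
  finally show ?thesis .
qed

lemma pm_eval_zero [simp]: "pm_eval m 0 = 0"
  by (simp add: pm_eval_def)

lemma pm_eval_sum: "pm_eval m (\<Sum>i\<in>I. p i) = (\<Sum>i\<in>I. pm_eval m (p i))"
  by (induction I rule: infinite_finite_induct) (auto simp: pm_eval_add)

lemma pm_eval_single [simp]: "pm_eval m (Poly_Mapping.single k c) = c * m k"
  by (simp add: pm_eval_superset[of "{k}"] )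

lemma poly_mapping_sum_single:
  "(\<Sum>k\<in>Poly_Mapping.keys p. Poly_Mapping.single k (Poly_Mapping.lookup p k)) = p"
  by (rule poly_mapping_eqI) (simp add: lookup_sum lookup_single when_def in_keys_iff)

text \<open>Both factors are expanded into single terms, for which the claim is exactly the
  multiplicativity of \<open>m\<close>.\<close>

lemma pm_eval_mult:
  fixes p q :: "'k::monoid_add \<Rightarrow>\<^sub>0 complex"
  assumes m: "\<And>j k. m (j + k) = m j * m k"
  shows "pm_eval m (p * q) = pm_eval m p * pm_eval m q"
proof -
  let ?s = "\<lambda>p k. Poly_Mapping.single k (Poly_Mapping.lookup p k)"
  have "pm_eval m (p * q) = pm_eval m ((\<Sum>j\<in>Poly_Mapping.keys p. ?s p j) * (\<Sum>k\<in>Poly_Mapping.keys q. ?s q k))"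
    by (simp only: poly_mapping_sum_single)
  also have "\<dots> = (\<Sum>j\<in>Poly_Mapping.keys p. \<Sum>k\<in>Poly_Mapping.keys q. pm_eval m (?s p j * ?s q k))"
    by (simp add: sum_product pm_eval_sum)
  also have "\<dots> = (\<Sum>j\<in>Poly_Mapping.keys p. \<Sum>k\<in>Poly_Mapping.keys q.
      Poly_Mapping.lookup p j * Poly_Mapping.lookup q k * (m j * m k))"
    by (simp add: mult_single m)
  also have "\<dots> = pm_eval m p * pm_eval m q"
    by (simp add: pm_eval_def sum_product mult_ac)
  finally show ?thesis .
qed

lemma pm_eval_power:
  fixes p :: "'k::monoid_add \<Rightarrow>\<^sub>0 complex"
  assumes m: "\<And>j k. m (j + k) = m j * m k" "m 0 = 1"
  shows "pm_eval m (p ^ n) = pm_eval m p ^ n"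
proof (induction n)
  case 0
  have "pm_eval m (Poly_Mapping.single 0 1) = 1" using m(2) by (simp only: pm_eval_single) simp
  then show ?case by simp
next
  case (Suc n)
  then show ?case by (simp add: pm_eval_mult m)
qed

section \<open>The monomial basis in degree \<open>m\<close>\<close>

lemma set_mons: "set (mons m) = {(a, b, c). a + b + c = m}"
proof -
  have "set (mons m) = (\<Union>a\<in>{0..<Suc m}. (\<lambda>b. (a, b, m - a - b)) ` {0..<Suc m - a})"
    by (simp add: mons_def del: upt_Suc)
  also have "\<dots> = {(a, b, c). a + b + c = m}"
  proof (intro subset_antisym subsetI)
    fix e assume "e \<in> {(a, b, c). a + b + c = m}"
    then obtain a b c where e: "e = (a, b, c)" "m = a + b + c" by auto
    then have "e \<in> (\<lambda>b. (a, b, m - a - b)) ` {0..<Suc m - a}" by (intro image_eqI[of _ _ b]) auto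
    moreover have "a \<in> {0..<Suc m}" using e by simp
    ultimately show "e \<in> (\<Union>a\<in>{0..<Suc m}. (\<lambda>b. (a, b, m - a - b)) ` {0..<Suc m - a})" by blast
  qed auto
  finally show ?thesis .
qed

lemma distinct_mons: "distinct (mons m)"
proof -
  let ?f = "\<lambda>a. map (\<lambda>b. (a, b, m - a - b)) [0..<Suc m - a]"
  have "inj_on ?f {0..<Suc m}"
  proof (rule inj_onI)
    fix x y assume xy: "x \<in> {0..<Suc m}" "y \<in> {0..<Suc m}" "?f x = ?f y"
    \<comment> \<open>Each inner list is nonempty, so its head reveals \<open>a\<close>.\<close>
    have hd: "fst (hd (?f a)) = a" if "a \<in> {0..<Suc m}" for a
      using that by (subst upt_conv_Cons) auto
    have "x = fst (hd (?f x))" using hd[OF xy(1)] by (rule sym)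
    also have "\<dots> = y" unfolding xy(3) by (rule hd[OF xy(2)])
    finally show "x = y" .
  qed
  then show ?thesis
    unfolding mons_def
    by (intro distinct_concat) (auto simp: distinct_map inj_on_def simp del: upt_Suc)
qed

lemma sum_mons: "(\<Sum>r<sym_dim m. f (mons m ! r)) = (\<Sum>e\<in>set (mons m). f e)"
  unfolding sym_dim_def
  using sum.reindex_bij_betw[OF bij_betw_nth[OF distinct_mons refl refl]] .

lemma lookup_mon_key:
  "Poly_Mapping.lookup (mon_key (a, b, c)) i = (if i = 0 then a else if i = 1 then b else if i = 2 then c else 0)"
  by (auto simp: mon_key_def lookup_add lookup_single when_def)

lemma inj_mon_key: "inj mon_key"
proof (rule injI)
  fix e f assume h: "mon_key e = mon_key f"
  obtain a b c a' b' c' where "e = (a, b, c)" "f = (a', b', c')" by (metis prod_cases3)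
  with h have "Poly_Mapping.lookup (mon_key (a, b, c)) i = Poly_Mapping.lookup (mon_key (a', b', c')) i" for i by simp
  from this[of 0] this[of 1] this[of 2] show "e = f"
    using \<open>e = _\<close> \<open>f = _\<close> by (simp add: lookup_mon_key)
qed

lemma mon_key_add: "mon_key (a, b, c) + mon_key (a', b', c') = mon_key (a + a', b + b', c + c')"
  by (simp add: mon_key_def single_add add_ac)

definition mon_val :: "(nat \<Rightarrow> complex) \<Rightarrow> nat \<times> nat \<times> nat \<Rightarrow> complex" where
  "mon_val x e = (case e of (a, b, c) \<Rightarrow> x 0 ^ a * x 1 ^ b * x 2 ^ c)"

text \<open>Counterpart of \<open>mon_val\<close> on arbitrary exponent functions, where addition is
  available and evaluation becomes multiplicative; only the variables 0, 1, 2 are read.\<close>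

definition key_val :: "(nat \<Rightarrow> complex) \<Rightarrow> (nat \<Rightarrow>\<^sub>0 nat) \<Rightarrow> complex" where
  "key_val x k = (\<Prod>i<3. x i ^ Poly_Mapping.lookup k i)"

lemma key_val_add: "key_val x (j + k) = key_val x j * key_val x k"
  by (simp add: key_val_def lookup_add power_add prod.distrib)

lemma key_val_zero [simp]: "key_val x 0 = 1"
  by (simp add: key_val_def)

lemma key_val_mon_key: "key_val x (mon_key e) = mon_val x e"
  by (cases e) (simp add: key_val_def mon_val_def lookup_mon_key numeral_3_eq_3 numeral_2_eq_2)

text \<open>The row vector x A. Its entry \<open>j\<close> is the value at the point
  \<open>x\<close> of the linear form attached to column \<open>j\<close>.\<close>

definition row_act :: "complex mat \<Rightarrow> (nat \<Rightarrow> complex) \<Rightarrow> nat \<Rightarrow> complex" where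
  "row_act A x j = (\<Sum>i<3. x i * A $$ (i, j))"

text \<open>Substituting linear forms into a monomial and then evaluating at \<open>x\<close> is
  evaluating the monomial at x A.\<close>

lemma pm_eval_mon_image: "pm_eval (key_val x) (mon_image A e) = mon_val (row_act A x) e"
proof -
  have kv: "key_val x (Poly_Mapping.single i (Suc 0)) = x i" if "i < 3" for i
  proof -
    have "key_val x (Poly_Mapping.single i (Suc 0)) = (\<Prod>j<3. if j = i then x i else 1)"
      unfolding key_val_def by (intro prod.cong refl) (simp add: lookup_single when_def)
    then show ?thesis using that by simp
  qed
  have "pm_eval (key_val x) (lin_form A j) = row_act A x j" for j
    by (auto simp: lin_form_def pm_eval_sum row_act_def kv mult.commute intro!: sum.cong)
  then show ?thesis
    by (cases e) (simp add: mon_image_def mon_val_def pm_eval_mult pm_eval_power key_val_add)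
qed

text \<open>Bounds the support by the listed basis monomials, so that the coefficients read off by
  \<open>sym_rep\<close> are all the coefficients there are.\<close>

definition homogeneous :: "nat \<Rightarrow> cpoly \<Rightarrow> bool" where
  "homogeneous m p \<longleftrightarrow> Poly_Mapping.keys p \<subseteq> mon_key ` set (mons m)"

lemma homogeneous_mult:
  assumes "homogeneous m p" "homogeneous n q"
  shows "homogeneous (m + n) (p * q)"
  unfolding homogeneous_def
proof
  fix k assume "k \<in> Poly_Mapping.keys (p * q)"
  then obtain i j where k: "k = i + j" "i \<in> Poly_Mapping.keys p" "j \<in> Poly_Mapping.keys q"
    using keys_mult[of p q] by blast
  obtain a b c where i: "i = mon_key (a, b, c)" "a + b + c = m"
    using assms(1) k(2) unfolding homogeneous_def set_mons by blast
  obtain a' b' c' where j: "j = mon_key (a', b', c')" "a' + b' + c' = n"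
    using assms(2) k(3) unfolding homogeneous_def set_mons by blast
  show "k \<in> mon_key ` set (mons (m + n))"
    unfolding k i j mon_key_add set_mons using i j by (intro imageI) auto
qed

lemma homogeneous_power:
  assumes "homogeneous 1 p"
  shows "homogeneous n (p ^ n)"
proof (induction n)
  case 0
  have "mon_key (0, 0, 0) = 0" by (simp add: mon_key_def)
  then have "0 \<in> mon_key ` set (mons 0)" unfolding set_mons by force
  then show ?case by (simp add: homogeneous_def)
next
  case (Suc n)
  then show ?case using homogeneous_mult[OF assms Suc] by simp
qed

lemma homogeneous_lin_form: "homogeneous 1 (lin_form A j)"
proof -
  have k: "Poly_Mapping.single i 1 \<in> mon_key ` set (mons 1)" if "i < 3" for i
  proof -
    have "i = 0 \<or> i = 1 \<or> i = 2" using that by auto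
    then have "Poly_Mapping.single i 1 \<in> mon_key ` {(1,0,0), (0,1,0), (0,0,1)}"
      by (auto simp: mon_key_def)
    moreover have "{(1,0,0), (0,1,0), (0,0,1)} \<subseteq> set (mons 1)" by (auto simp: set_mons)
    ultimately show ?thesis by blast
  qed
  have "Poly_Mapping.keys (lin_form A j) \<subseteq>
      (\<Union>i<3. Poly_Mapping.keys (Poly_Mapping.single (Poly_Mapping.single i 1) (A $$ (i, j))))"
    unfolding lin_form_def by (rule keys_sum)
  also have "\<dots> \<subseteq> mon_key ` set (mons 1)" using k by (auto split: if_splits)
  finally show ?thesis by (simp add: homogeneous_def)
qed

lemma homogeneous_mon_image:
  assumes "e \<in> set (mons m)"
  shows "homogeneous m (mon_image A e)"
proof -
  obtain a b c where e: "e = (a, b, c)" "m = a + b + c" using assms by (auto simp: set_mons)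
  have "homogeneous n (lin_form A j ^ n)" for n j by (rule homogeneous_power[OF homogeneous_lin_form])
  then show ?thesis unfolding e mon_image_def prod.case by (intro homogeneous_mult)
qed

section \<open>Symmetric powers determined by values at points\<close>

lemma sym_rep_carrier: "sym_rep m A \<in> carrier_mat (sym_dim m) (sym_dim m)"
  by (simp add: sym_rep_def)

text \<open>Column \<open>s\<close> holds the coefficients of the image of monomial
  \<open>s\<close>; by homogeneity nothing is lost when that image is evaluated over the basis
  monomials only.\<close>

lemma sym_rep_action:
  assumes s: "s < sym_dim m"
  shows "mon_val (row_act A x) (mons m ! s) = (\<Sum>r<sym_dim m. sym_rep m A $$ (r, s) * mon_val x (mons m ! r))"
proof -
  let ?p = "mon_image A (mons m ! s)"
  have "mons m ! s \<in> set (mons m)" using s by (simp add: sym_dim_def)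
  then have hom: "Poly_Mapping.keys ?p \<subseteq> mon_key ` set (mons m)"
    using homogeneous_mon_image by (simp add: homogeneous_def)
  have "mon_val (row_act A x) (mons m ! s) = pm_eval (key_val x) ?p"
    by (simp add: pm_eval_mon_image)
  also have "\<dots> = (\<Sum>k\<in>mon_key ` set (mons m). Poly_Mapping.lookup ?p k * key_val x k)"
    by (rule pm_eval_superset[OF _ hom]) simp
  also have "\<dots> = (\<Sum>e\<in>set (mons m). Poly_Mapping.lookup ?p (mon_key e) * mon_val x e)"
    by (subst sum.reindex) (auto simp: key_val_mon_key intro: inj_on_subset[OF inj_mon_key])
  also have "\<dots> = (\<Sum>r<sym_dim m. Poly_Mapping.lookup ?p (mon_key (mons m ! r)) * mon_val x (mons m ! r))"
    by (rule sum_mons[symmetric])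
  also have "\<dots> = (\<Sum>r<sym_dim m. sym_rep m A $$ (r, s) * mon_val x (mons m ! r))"
    using s by (intro sum.cong refl) (simp add: sym_rep_def)
  finally show ?thesis .
qed

text \<open>The Kronecker substitution \<open>x\<^sub>i = z ^ (K ^ i)\<close> with \<open>K = m + 1\<close> separates the monomials of degree \<open>m\<close>.\<close>
lemma monomials_independent:
  fixes f :: "nat \<times> nat \<times> nat \<Rightarrow> complex"
  assumes z: "\<And>x. (\<Sum>e\<in>set (mons m). f e * mon_val x e) = 0" and e: "e \<in> set (mons m)"
  shows "f e = 0"
proof -
  define K where "K = Suc m"
  define w where "w = (\<lambda>(a, b, c). a + K * (b + K * c))"
  have digit: "a = a' \<and> q = q'" if "a + K * q = a' + K * q'" "a < K" "a' < K" for a a' q q'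
  proof -
    have "(a + K * q) mod K = (a' + K * q') mod K" by (simp only: that(1))
    then have "a = a'" using that(2,3) by simp
    then show ?thesis using that by simp
  qed
  have inj: "inj_on w (set (mons m))"
  proof (rule inj_onI)
    fix e e' assume h: "e \<in> set (mons m)" "e' \<in> set (mons m)" "w e = w e'"
    obtain a b c where e: "e = (a, b, c)" "a + b + c = m" using h(1) by (auto simp: set_mons)
    obtain a' b' c' where e': "e' = (a', b', c')" "a' + b' + c' = m" using h(2) by (auto simp: set_mons)
    have w: "a + K * (b + K * c) = a' + K * (b' + K * c')"
      using h(3) by (simp add: w_def e e')
    have lt: "a < K" "b < K" "a' < K" "b' < K" using e e' by (auto simp: K_def)
    have a: "a = a'" and bc: "b + K * c = b' + K * c'" using digit[OF w] lt by auto
    have "b = b'" using digit[OF bc] lt by auto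
    then show "e = e'" using a e e' by auto
  qed
  define p where "p = (\<Sum>e\<in>set (mons m). Polynomial.monom (f e) (w e))"
  \<comment> \<open>The powers \<open>K ^ 0\<close> and \<open>K ^ 1\<close> stay unsimplified so
    that the right side is literally \<open>mon_val\<close> at the points
    \<open>y ^ K ^ i\<close>.\<close>
  have kr: "y ^ (a + K * (b + K * c)) = (y ^ K ^ 0) ^ a * (y ^ K ^ 1) ^ b * (y ^ K ^ 2) ^ c" for y :: complex and a b c
  proof -
    have "a + K * (b + K * c) = a + K * b + K * K * c" by (simp add: algebra_simps)
    then show ?thesis by (simp only: power_add power_mult power_0 power_one_right power2_eq_square)
  qed
  have "poly p y = (\<Sum>e\<in>set (mons m). f e * mon_val (\<lambda>i. y ^ K ^ i) e)" for y
    unfolding p_def poly_sum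
    by (intro sum.cong refl) (auto simp: poly_monom mon_val_def w_def kr simp del: power_0 power_one_right split: prod.splits)
  \<comment> \<open>A polynomial over an infinite field that vanishes at every point is zero; its
    coefficient at \<open>w e\<close> is \<open>f e\<close> because \<open>w\<close> is
    injective.\<close>
  then have "p = 0" using z by (simp add: poly_eq_poly_eq_iff[symmetric] fun_eq_iff)
  then have "0 = coeff p (w e)" by simp
  also have "\<dots> = (\<Sum>e'\<in>set (mons m). if e' = e then f e' else 0)"
    unfolding p_def coeff_sum by (intro sum.cong refl) (use inj e in \<open>auto dest: inj_onD\<close>)
  also have "\<dots> = f e" using e by simp
  finally show ?thesis by simp
qed

text \<open>Independence of the monomials as functions makes the action on values a characterization
  of \<open>sym_rep m A\<close>. Multiplicativity and the identity law then need no manipulation of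
  polynomials.\<close>

lemma sym_rep_unique:
  assumes M: "M \<in> carrier_mat (sym_dim m) (sym_dim m)"
    and act: "\<And>x s. s < sym_dim m \<Longrightarrow>
      mon_val (row_act A x) (mons m ! s) = (\<Sum>r<sym_dim m. M $$ (r, s) * mon_val x (mons m ! r))"
  shows "sym_rep m A = M"
proof (rule eq_matI)
  fix r s assume "r < dim_row M" "s < dim_col M"
  then have rs: "r < sym_dim m" "s < sym_dim m" using M by auto
  \<comment> \<open>Independence speaks of exponent triples, while \<open>M\<close> is indexed by
    positions in the list; the inverse of list indexing translates.\<close>
  define f where "f = (\<lambda>e. Poly_Mapping.lookup (mon_image A (mons m ! s)) (mon_key e)
     - M $$ (the_inv_into {..<sym_dim m} ((!) (mons m)) e, s))"
  have inj: "inj_on ((!) (mons m)) {..<sym_dim m}"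
    using distinct_mons by (auto simp: sym_dim_def inj_on_nth)
  have f: "f (mons m ! q) = sym_rep m A $$ (q, s) - M $$ (q, s)" if "q < sym_dim m" for q
    using that rs by (simp add: f_def the_inv_into_f_f[OF inj] sym_rep_def)
  have "(\<Sum>e\<in>set (mons m). f e * mon_val x e) = 0" for x
    unfolding sum_mons[symmetric] using sym_rep_action[OF rs(2), of A x] act[OF rs(2), of x]
    by (simp add: f left_diff_distrib sum_subtractf)
  then have "f (mons m ! r) = 0"
    by (rule monomials_independent) (use rs in \<open>simp add: sym_dim_def\<close>)
  then show "sym_rep m A $$ (r, s) = M $$ (r, s)" using f[OF rs(1)] by simp
qed (use M in \<open>auto simp: sym_rep_def\<close>)

lemma row_act_mult:
  assumes A: "A \<in> carrier_mat 3 3" and B: "B \<in> carrier_mat 3 3" and j: "j < 3"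
  shows "row_act (A * B) x j = row_act B (row_act A x) j"
proof -
  have "row_act (A * B) x j = (\<Sum>i<3. \<Sum>p<3. x i * (A $$ (i, p) * B $$ (p, j)))"
    unfolding row_act_def using j
    by (intro sum.cong refl) (simp add: mult_mat_entry[OF A B] sum_distrib_left del: index_mult_mat(1))
  also have "\<dots> = row_act B (row_act A x) j"
    unfolding row_act_def by (subst sum.swap) (simp add: sum_distrib_right mult.assoc)
  finally show ?thesis .
qed

lemma mon_val_cong: "(\<And>i. i < 3 \<Longrightarrow> x i = y i) \<Longrightarrow> mon_val x e = mon_val y e"
  by (simp add: mon_val_def split: prod.splits)

text \<open>Comes from x (A B) = (x A) B, by applying the action on values twice.\<close>

lemma sym_rep_mult:
  assumes A: "A \<in> carrier_mat 3 3" and B: "B \<in> carrier_mat 3 3"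
  shows "sym_rep m (A * B) = sym_rep m A * sym_rep m B"
proof (rule sym_rep_unique)
  show "sym_rep m A * sym_rep m B \<in> carrier_mat (sym_dim m) (sym_dim m)"
    by (rule mult_carrier_mat[OF sym_rep_carrier sym_rep_carrier])
  fix x s assume s: "s < sym_dim m"
  have "mon_val (row_act (A * B) x) (mons m ! s) = mon_val (row_act B (row_act A x)) (mons m ! s)"
    by (intro mon_val_cong row_act_mult A B)
  also have "\<dots> = (\<Sum>p<sym_dim m. sym_rep m B $$ (p, s) * mon_val (row_act A x) (mons m ! p))"
    by (rule sym_rep_action[OF s])
  also have "\<dots> = (\<Sum>p<sym_dim m. \<Sum>r<sym_dim m.
      sym_rep m A $$ (r, p) * sym_rep m B $$ (p, s) * mon_val x (mons m ! r))"
    by (intro sum.cong refl) (simp add: sym_rep_action sum_distrib_left mult_ac)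
  also have "\<dots> = (\<Sum>r<sym_dim m. (sym_rep m A * sym_rep m B) $$ (r, s) * mon_val x (mons m ! r))"
    by (subst sum.swap, intro sum.cong refl)
      (simp add: mult_mat_entry[OF sym_rep_carrier sym_rep_carrier] s sum_distrib_right del: index_mult_mat(1))
  finally show "mon_val (row_act (A * B) x) (mons m ! s)
      = (\<Sum>r<sym_dim m. (sym_rep m A * sym_rep m B) $$ (r, s) * mon_val x (mons m ! r))" .
qed

lemma sym_rep_one: "sym_rep m (1\<^sub>m 3) = 1\<^sub>m (sym_dim m)"
proof (rule sym_rep_unique)
  fix x s assume s: "s < sym_dim m"
  have "row_act (1\<^sub>m 3) x i = x i" if "i < 3" for i
    using that by (simp add: row_act_def if_distrib sum.delta cong: if_cong)
  then have "mon_val (row_act (1\<^sub>m 3) x) (mons m ! s) = mon_val x (mons m ! s)"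
    by (rule mon_val_cong)
  also have "\<dots> = (\<Sum>r<sym_dim m. if r = s then mon_val x (mons m ! r) else 0)" using s by simp
  also have "\<dots> = (\<Sum>r<sym_dim m. 1\<^sub>m (sym_dim m) $$ (r, s) * mon_val x (mons m ! r))"
    using s by (intro sum.cong refl) simp
  finally show "mon_val (row_act (1\<^sub>m 3) x) (mons m ! s)
      = (\<Sum>r<sym_dim m. 1\<^sub>m (sym_dim m) $$ (r, s) * mon_val x (mons m ! r))" .
qed simp

text \<open>
  With weight \<open>i\<close> on the variable \<open>x\<^sub>i\<close>, an upper triangular matrix sends \<open>x\<^sub>j\<close> to its diagonal multiple
  plus terms of lower weight, and this property is multiplicative.
\<close>
definition lead_form :: "cpoly \<Rightarrow> (nat \<Rightarrow>\<^sub>0 nat) \<Rightarrow> complex \<Rightarrow> bool" where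
  "lead_form p k c \<longleftrightarrow> (\<exists>r. p = Poly_Mapping.single k c + r \<and>
     (\<forall>j\<in>Poly_Mapping.keys r. Poly_Mapping.lookup j 1 + 2 * Poly_Mapping.lookup j 2
       < Poly_Mapping.lookup k 1 + 2 * Poly_Mapping.lookup k 2))"

lemma lead_form_mult:
  assumes "lead_form p k c" "lead_form p' k' c'"
  shows "lead_form (p * p') (k + k') (c * c')"
proof -
  let ?w = "\<lambda>j :: nat \<Rightarrow>\<^sub>0 nat. Poly_Mapping.lookup j 1 + 2 * Poly_Mapping.lookup j (2::nat)"
  let ?s = "Poly_Mapping.single k c" and ?s' = "Poly_Mapping.single k' c'"
  obtain r where r: "p = ?s + r" "\<forall>j\<in>Poly_Mapping.keys r. ?w j < ?w k"
    using assms(1) by (auto simp: lead_form_def)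
  obtain r' where r': "p' = ?s' + r'" "\<forall>j\<in>Poly_Mapping.keys r'. ?w j < ?w k'"
    using assms(2) by (auto simp: lead_form_def)
  have w: "?w (i + j) = ?w i + ?w j" for i j by (simp add: lookup_add distrib_left)
  \<comment> \<open>Each of the three products contains a remainder factor and therefore has weight
    strictly below that of \<open>k + k'\<close>.\<close>
  let ?q = "?s * r' + r * ?s' + r * r'"
  have eq: "p * p' = Poly_Mapping.single (k + k') (c * c') + ?q"
    by (simp add: r(1) r'(1) algebra_simps mult_single)
  have "?w j < ?w (k + k')" if "j \<in> Poly_Mapping.keys ?q" for j
  proof -
    have "j \<in> Poly_Mapping.keys (?s * r') \<or> j \<in> Poly_Mapping.keys (r * ?s') \<or> j \<in> Poly_Mapping.keys (r * r')"
      using that Poly_Mapping.keys_add[of "?s * r' + r * ?s'" "r * r'"] Poly_Mapping.keys_add[of "?s * r'" "r * ?s'"] by blast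
    then consider a b where "j = a + b" "a \<in> Poly_Mapping.keys ?s" "b \<in> Poly_Mapping.keys r'"
      | a b where "j = a + b" "a \<in> Poly_Mapping.keys r" "b \<in> Poly_Mapping.keys ?s'"
      | a b where "j = a + b" "a \<in> Poly_Mapping.keys r" "b \<in> Poly_Mapping.keys r'"
      using keys_mult by blast
    then show ?thesis
    proof cases
      case 1
      then have "a = k" by (auto split: if_splits)
      then show ?thesis using 1 r' w by simp
    next
      case 2
      then have "b = k'" by (auto split: if_splits)
      then show ?thesis using 2 r w by simp
    next
      case 3
      then show ?thesis using r r' w by (auto intro: add_strict_mono)
    qed
  qed
  then show ?thesis unfolding lead_form_def using eq by blast
qed

lemma lead_form_one: "lead_form 1 0 1"
  unfolding lead_form_def by (intro exI[of _ 0]) simp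

lemma lead_form_power:
  assumes "lead_form p (Poly_Mapping.single i 1) c"
  shows "lead_form (p ^ n) (Poly_Mapping.single i n) (c ^ n)"
proof (induction n)
  case 0
  show ?case using lead_form_one by simp
next
  case (Suc n)
  have "Poly_Mapping.single i (Suc n) = Poly_Mapping.single i 1 + Poly_Mapping.single i n"
    by (simp flip: single_add)
  then show ?case using lead_form_mult[OF assms Suc] by simp
qed

text \<open>The remainder has only keys of weight strictly below that of \<open>k\<close>, so
  \<open>k\<close> is not among them.\<close>

lemma lead_form_coeff: "lead_form p k c \<Longrightarrow> Poly_Mapping.lookup p k = c"
  unfolding lead_form_def
  by (auto simp: lookup_add in_keys_iff)

lemma lead_form_lin_form:
  assumes "upper_triangular A" "A \<in> carrier_mat 3 3" "j < 3"
  shows "lead_form (lin_form A j) (Poly_Mapping.single j 1) (A $$ (j, j))"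
proof -
  let ?t = "\<lambda>i. Poly_Mapping.single (Poly_Mapping.single i (1::nat)) (A $$ (i, j))"
  have "lin_form A j = ?t j + (\<Sum>i\<in>{..<3} - {j}. ?t i)"
    unfolding lin_form_def using assms(3) by (intro sum.remove) auto
  \<comment> \<open>Triangularity removes the terms with i > j; the surviving variables have smaller
    weight than variable \<open>j\<close>.\<close>
  also have "(\<Sum>i\<in>{..<3} - {j}. ?t i) = (\<Sum>i<j. ?t i)"
  proof (rule sum.mono_neutral_right)
    show "\<forall>i\<in>{..<3} - {j} - {..<j}. ?t i = 0"
      using upper_triangularD[OF assms(1)] assms(2) by auto
  qed (use assms(3) in auto)
  finally have eq: "lin_form A j = ?t j + (\<Sum>i<j. ?t i)" .
  have "Poly_Mapping.keys (\<Sum>i<j. ?t i) \<subseteq> (\<Union>i<j. Poly_Mapping.keys (?t i))" by (rule keys_sum)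
  also have "\<dots> \<subseteq> (\<lambda>i. Poly_Mapping.single i 1) ` {..<j}" by auto
  finally have "\<exists>i<j. k = Poly_Mapping.single i 1" if "k \<in> Poly_Mapping.keys (\<Sum>i<j. ?t i)" for k using that by auto
  moreover have "Poly_Mapping.lookup (Poly_Mapping.single i (1::nat)) 1 + 2 * Poly_Mapping.lookup (Poly_Mapping.single i (1::nat)) 2 = i"
    if "i < 3" for i :: nat
    using that by (auto simp: lookup_single when_def)
  ultimately show ?thesis unfolding lead_form_def eq using assms(3)
    by (intro exI[of _ "\<Sum>i<j. ?t i"]) fastforce
qed

text \<open>The diagonal entry at a monomial is its leading coefficient, the same monomial evaluated
  at the diagonal of \<open>A\<close>.\<close>

lemma mtrace_sym_rep_triangular:
  assumes "upper_triangular A" "A \<in> carrier_mat 3 3"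
  shows "mtrace (sym_rep m A) = (\<Sum>e\<in>set (mons m). mon_val (\<lambda>i. A $$ (i, i)) e)"
proof -
  have d: "Poly_Mapping.lookup (mon_image A e) (mon_key e) = mon_val (\<lambda>i. A $$ (i, i)) e" for e
  proof -
    obtain a b c where e: "e = (a, b, c)" by (rule prod_cases3)
    have "lead_form (mon_image A e) (mon_key e) (mon_val (\<lambda>i. A $$ (i, i)) e)"
      unfolding e mon_image_def mon_key_def mon_val_def prod.case
      by (rule lead_form_mult[OF lead_form_mult]; rule lead_form_power[OF lead_form_lin_form[OF assms]]) simp_all
    then show ?thesis by (rule lead_form_coeff)
  qed
  have "mtrace (sym_rep m A) = (\<Sum>r<sym_dim m. mon_val (\<lambda>i. A $$ (i, i)) (mons m ! r))"
    by (simp add: mtrace_def sym_rep_def d)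
  also have "\<dots> = (\<Sum>e\<in>set (mons m). mon_val (\<lambda>i. A $$ (i, i)) e)" by (rule sum_mons)
  finally show ?thesis .
qed

lemma mtrace_similar:
  assumes "P \<in> carrier_mat n n" "Q \<in> carrier_mat n n" "A \<in> carrier_mat n n" "Q * P = 1\<^sub>m n"
  shows "mtrace (P * A * Q) = mtrace A"
proof -
  have "mtrace (P * A * Q) = mtrace (Q * (P * A))" using assms by (intro mtrace_mult_commute[of _ n n]) auto
  also have "Q * (P * A) = A" using assoc_mult_mat[OF assms(2,1,3)] assms by simp
  finally show ?thesis .
qed

section \<open>The generating function of the traces on symmetric powers\<close>

lemma fps_geometric_mult:
  "(1 - fps_const c * fps_X) * Abs_fps (\<lambda>n. c ^ n) = (1 :: complex fps)"
proof (rule fps_ext)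
  fix n
  show "fps_nth ((1 - fps_const c * fps_X) * Abs_fps (\<lambda>n. c ^ n)) n = fps_nth (1 :: complex fps) n"
    by (cases n) (simp_all add: left_diff_distrib mult.assoc)
qed

text \<open>Nested Cauchy product: the exponents \<open>a\<close> and \<open>b\<close> are free and
  the third is m - a - b.\<close>

lemma complete_symmetric_fps:
  "Abs_fps (\<lambda>m. \<Sum>e\<in>set (mons m). mon_val x e)
    = Abs_fps (\<lambda>n. x 0 ^ n) * (Abs_fps (\<lambda>n. x 1 ^ n) * Abs_fps (\<lambda>n. x 2 ^ n))"
proof (rule fps_ext)
  fix m
  have "(\<Sum>e\<in>set (mons m). mon_val x e)
      = (\<Sum>(a, b)\<in>(SIGMA a:{0..m}. {0..m - a}). x 0 ^ a * (x 1 ^ b * x 2 ^ (m - a - b)))"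
    unfolding set_mons
    by (rule sum.reindex_bij_witness[of _ "\<lambda>(a, b). (a, b, m - a - b)" "\<lambda>(a, b, c). (a, b)"])
      (auto simp: mon_val_def)
  also have "\<dots> = (\<Sum>a = 0..m. \<Sum>b = 0..m - a. x 0 ^ a * (x 1 ^ b * x 2 ^ (m - a - b)))"
    by (rule sum.Sigma[symmetric]) auto
  finally show "fps_nth (Abs_fps (\<lambda>m. \<Sum>e\<in>set (mons m). mon_val x e)) m
    = fps_nth (Abs_fps (\<lambda>n. x 0 ^ n) * (Abs_fps (\<lambda>n. x 1 ^ n) * Abs_fps (\<lambda>n. x 2 ^ n))) m"
    by (simp add: fps_mult_nth sum_distrib_left)
qed

lemma sum_lessThan_3: "(\<Sum>p<3. f p) = f 0 + f 1 + f (2::nat)"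
  for f :: "nat \<Rightarrow> complex"
  by (simp add: numeral_3_eq_3 numeral_2_eq_2)

text \<open>The diagonal of the inverse consists of the reciprocals of that of \<open>T\<close>, and
  with determinant 1 each reciprocal is the product of the other two entries.\<close>

lemma triangular_inverse_trace:
  assumes T: "T \<in> carrier_mat 3 3" "upper_triangular T" and S: "S \<in> carrier_mat 3 3"
    and TS: "T * S = 1\<^sub>m 3" and dt: "T $$ (0,0) * T $$ (1,1) * T $$ (2,2) = 1"
  shows "mtrace S = T $$ (0,0) * T $$ (1,1) + T $$ (0,0) * T $$ (2,2) + T $$ (1,1) * T $$ (2,2)"
proof -
  have z: "T $$ (1,0) = 0" "T $$ (2,0) = 0" "T $$ (2,1) = 0"
    using upper_triangularD[OF T(2)] T(1) by auto
  have nz: "T $$ (0,0) \<noteq> 0" "T $$ (1,1) \<noteq> 0" "T $$ (2,2) \<noteq> 0" using dt by auto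
  have e: "(\<Sum>p<3. T $$ (i, p) * S $$ (p, j)) = (if i = j then 1 else 0)" if "i < 3" "j < 3" for i j
    using mult_mat_entry[OF T(1) S that] TS that by simp
  \<comment> \<open>Back substitution from the last row upwards: each row first clears the entries
    of \<open>S\<close> below the diagonal, then yields the diagonal one.\<close>
  have a: "S $$ (2,0) = 0" "S $$ (2,1) = 0" "T $$ (2,2) * S $$ (2,2) = 1"
    using e[of 2 0] e[of 2 1] e[of 2 2] nz by (simp_all add: sum_lessThan_3 z del: One_nat_def)
  have b: "S $$ (1,0) = 0" "T $$ (1,1) * S $$ (1,1) = 1"
    using e[of 1 0] e[of 1 1] nz a by (simp_all add: sum_lessThan_3 z del: One_nat_def)
  have c: "T $$ (0,0) * S $$ (0,0) = 1"
    using e[of 0 0] nz a b by (simp add: sum_lessThan_3 z del: One_nat_def)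
  have "S $$ (0,0) = (T $$ (0,0) * T $$ (1,1) * T $$ (2,2)) * S $$ (0,0)"
    "S $$ (1,1) = (T $$ (0,0) * T $$ (1,1) * T $$ (2,2)) * S $$ (1,1)"
    "S $$ (2,2) = (T $$ (0,0) * T $$ (1,1) * T $$ (2,2)) * S $$ (2,2)" using dt by simp_all
  then have "S $$ (0,0) = T $$ (1,1) * T $$ (2,2)" "S $$ (1,1) = T $$ (0,0) * T $$ (2,2)" "S $$ (2,2) = T $$ (0,0) * T $$ (1,1)"
    using a b c by (metis (no_types, lifting) mult.assoc mult.commute mult.right_neutral)+
  then show ?thesis using S by (simp add: mtrace_def sum_lessThan_3)
qed

text \<open>After triangularization the first factor is the product of the 1 - t_i X over the
  diagonal entries t_i of \<open>T\<close>, and the series of traces is the product of the three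
  geometric series inverting these factors.\<close>

lemma sym_character_fps:
  assumes g: "g \<in> carrier_mat 3 3" and h: "h \<in> carrier_mat 3 3" and gh: "g * h = 1\<^sub>m 3" and dg: "det g = 1"
  shows "(1 - fps_const (mtrace g) * fps_X + fps_const (mtrace h) * fps_X ^ 2 - fps_X ^ 3)
    * Abs_fps (\<lambda>m. mtrace (sym_rep m g)) = 1"
proof -
  obtain es where "char_poly g = (\<Prod>a\<leftarrow>es. [:- a, 1:])" using char_poly_factorized[OF g] by auto
  then obtain T where T: "T \<in> carrier_mat 3 3" "upper_triangular T" "similar_mat g T"
    using schur_decomposition_exists[OF g] by auto
  then obtain P Q where PQ: "P \<in> carrier_mat 3 3" "Q \<in> carrier_mat 3 3" "P * Q = 1\<^sub>m 3" "Q * P = 1\<^sub>m 3" "g = P * T * Q"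
    using g by (auto simp: similar_mat_def similar_mat_wit_def Let_def)
  let ?t = "\<lambda>i. T $$ (i, i)"
  have trg: "mtrace g = ?t 0 + ?t 1 + ?t 2"
    using mtrace_similar[OF PQ(1,2) T(1) PQ(4)] PQ(5) T(1) by (simp add: mtrace_def sum_lessThan_3)
  have dt: "?t 0 * ?t 1 * ?t 2 = 1"
  proof -
    have "det T = 1" using det_similar[OF T(3)] dg by simp
    then show ?thesis using det_upper_triangular[OF T(2,1)] T(1)
      by (simp add: diag_mat_def upt_rec mult.assoc numeral_2_eq_2)
  qed
  \<comment> \<open>Conjugating \<open>h\<close> by the same pair gives the inverse of
    \<open>T\<close>.\<close>
  let ?S = "Q * h * P"
  have S: "?S \<in> carrier_mat 3 3" using PQ h by auto
  have "T = Q * g * P"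
  proof -
    have "Q * g * P = Q * (P * T * Q) * P" by (simp only: PQ(5))
    also have "\<dots> = (Q * P) * T * (Q * P)" using PQ(1,2) T(1) by (simp add: assoc_mult_mat[of _ 3 3 _ 3 _ 3])
    also have "\<dots> = T" using PQ(4) T(1) by simp
    finally show ?thesis by simp
  qed
  then have "T * ?S = Q * g * P * (Q * h * P)" by simp
  also have "\<dots> = Q * (g * ((P * Q) * h)) * P" using PQ(1,2) g h by (simp add: assoc_mult_mat[of _ 3 3 _ 3 _ 3])
  also have "\<dots> = 1\<^sub>m 3" using PQ(1-4) h gh by simp
  finally have "mtrace ?S = ?t 0 * ?t 1 + ?t 0 * ?t 2 + ?t 1 * ?t 2"
    by (rule triangular_inverse_trace[OF T(1,2) S _ dt])
  then have trh: "mtrace h = ?t 0 * ?t 1 + ?t 0 * ?t 2 + ?t 1 * ?t 2"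
    using mtrace_similar[OF PQ(2,1) h PQ(3)] by simp
  have sym: "mtrace (sym_rep m g) = (\<Sum>e\<in>set (mons m). mon_val ?t e)" for m
  proof -
    have "sym_rep m g = sym_rep m P * sym_rep m T * sym_rep m Q"
      unfolding PQ(5) sym_rep_mult[OF mult_carrier_mat[OF PQ(1) T(1)] PQ(2)] sym_rep_mult[OF PQ(1) T(1)] ..
    moreover have "sym_rep m Q * sym_rep m P = 1\<^sub>m (sym_dim m)"
      using sym_rep_mult[OF PQ(2,1)] PQ(4) sym_rep_one by simp
    ultimately have "mtrace (sym_rep m g) = mtrace (sym_rep m T)"
      using mtrace_similar[OF sym_rep_carrier sym_rep_carrier sym_rep_carrier] by simp
    then show ?thesis using mtrace_sym_rep_triangular[OF T(2,1)] by simp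
  qed
  let ?L = "\<lambda>i. 1 - fps_const (?t i) * fps_X" and ?H = "\<lambda>i. Abs_fps (\<lambda>n. ?t i ^ n)"
  \<comment> \<open>Determinant 1 allows the coefficient of X^3 to be written as the product of the
    eigenvalues, as the factorization requires.\<close>
  have c3: "fps_const (?t 0) * fps_const (?t 1) * fps_const (?t 2) = (1 :: complex fps)"
    using dt by (simp add: fps_const_mult)
  have "1 - fps_const (mtrace g) * fps_X + fps_const (mtrace h) * fps_X ^ 2 - fps_X ^ 3
     = 1 - fps_const (mtrace g) * fps_X + fps_const (mtrace h) * fps_X ^ 2
       - (fps_const (?t 0) * fps_const (?t 1) * fps_const (?t 2)) * fps_X ^ 3" by (simp only: c3 mult_1)
  also have "\<dots> = ?L 0 * ?L 1 * ?L 2"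
    unfolding trg trh
    by (simp only: fps_const_add[symmetric] fps_const_mult[symmetric]) (simp only: power2_eq_square power3_eq_cube ring_distribs mult_ac, simp add: algebra_simps)
  finally have L: "1 - fps_const (mtrace g) * fps_X + fps_const (mtrace h) * fps_X ^ 2 - fps_X ^ 3 = ?L 0 * ?L 1 * ?L 2" .
  have "?L 0 * ?L 1 * ?L 2 * (?H 0 * (?H 1 * ?H 2)) = (?L 0 * ?H 0) * (?L 1 * ?H 1) * (?L 2 * ?H 2)"
    by (simp only: mult_ac)
  also have "\<dots> = 1" by (simp only: fps_geometric_mult) simp
  finally show ?thesis unfolding L sym complete_symmetric_fps .
qed

subsection \<open>Multiplicities and invariants\<close>

lemma decomposes_character:
  assumes irr: "irr_list G l d gam" and dec: "decomposes G n \<rho> l d gam c"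
    and g: "g \<in> G" and r: "\<rho> g \<in> carrier_mat n n"
  shows "mtrace (\<rho> g) = (\<Sum>i\<le>l. of_nat (c i) * mtrace (gam i g))"
proof -
  have c: "gam i g \<in> carrier_mat (d i) (d i)" if "i \<le> l" for i
    using irr that g by (auto simp: irr_list_def irreducible_rep_def is_rep_def)
  have iso: "rep_iso G n \<rho> (dsum_rep l gam c)" and n: "n = (\<Sum>i\<le>l. c i * d i)"
    using dec by (auto simp: decomposes_def)
  have "mtrace (\<rho> g) = mtrace (dsum_rep l gam c g)"
    using rep_iso_mtrace[OF iso g r] mtrace_dsum_rep(1)[of l gam g d c, OF c] n by simp
  then show ?thesis using mtrace_dsum_rep(2)[of l gam g d c, OF c] by simp
qed

lemma trivial_character:
  assumes irr: "irr_list G l d gam" and g: "g \<in> G"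
  shows "mtrace (gam 0 g) = 1"
proof -
  have d: "d 0 = 1" and iso: "rep_iso G 1 (gam 0) (\<lambda>_. 1\<^sub>m 1)" and "irreducible_rep G (d 0) (gam 0)"
    using irr by (auto simp: irr_list_def)
  then have "gam 0 g \<in> carrier_mat 1 1" using g by (simp add: irreducible_rep_def is_rep_def)
  then have "mtrace (gam 0 g) = mtrace (1\<^sub>m 1)" using rep_iso_mtrace[OF iso g] by simp
  then show ?thesis by simp
qed

text \<open>Rank factorization e = N C, where the columns of \<open>N\<close> form a basis of the
  fixed space and \<open>C\<close> records coordinates. Since C N is the identity of size
  \<open>r\<close>, the trace of \<open>e\<close> is \<open>r\<close>.\<close>

lemma idempotent_trace:
  assumes e: "e \<in> carrier_mat n n" and ee: "e * e = (e :: complex mat)"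
  shows "of_nat (vectorspace.dim class_ring
     ((module_vec TYPE(complex) n)\<lparr>carrier := {x \<in> carrier_vec n. e *\<^sub>v x = x}\<rparr>)) = mtrace e"
proof -
  let ?A = "e - 1\<^sub>m n"
  have A: "?A \<in> carrier_mat n n" by (rule minus_carrier_mat) simp
  have ker: "{x \<in> carrier_vec n. e *\<^sub>v x = x} = mat_kernel ?A"
  proof -
    have "?A *\<^sub>v x = 0\<^sub>v n \<longleftrightarrow> e *\<^sub>v x = x" if x: "x \<in> carrier_vec n" for x
    proof -
      have "?A *\<^sub>v x = e *\<^sub>v x - x" using e x by (simp add: minus_mult_distrib_mat_vec[of _ n n])
      moreover have "e *\<^sub>v x - x = 0\<^sub>v n \<longleftrightarrow> e *\<^sub>v x = x"
        using e x by (auto simp: vec_eq_iff)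
      ultimately show ?thesis by simp
    qed
    then show ?thesis by (auto simp: mat_kernel[OF A])
  qed
  interpret kernel n n ?A by (unfold_locales) (rule A)
  obtain S where S: "finite S" "basis S" using kernel_basis_exists[OF A] by blast
  obtain ws where ws: "set ws = S" "distinct ws" using finite_distinct_list[OF S(1)] by blast
  have SK: "S \<subseteq> mat_kernel ?A" using S(2) by (simp add: Ker.basis_def)
  then have Sc: "S \<subseteq> carrier_vec n" using mat_kernel_carrier[OF A] by blast
  define r where "r = length ws"
  have dim: "dim = r" using Ker.dim_basis[OF S] distinct_card[OF ws(2)] ws(1) by (simp add: r_def)
  define N where "N = mat_of_cols n ws"
  have N: "N \<in> carrier_mat n r" by (simp add: N_def r_def)
  have colN: "col N j = ws ! j" if "j < r" for j
    using that Sc ws(1) nth_mem[of j ws] by (auto simp: N_def r_def intro!: col_mat_of_cols)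
  have dws: "\<forall>w\<in>set ws. dim_vec w = n" using Sc ws(1) carrier_vecD by blast
  have lc: "NC.lincomb f S = N *\<^sub>v vec r (\<lambda>i. f (ws ! i))" for f
    using NC.lincomb_as_lincomb_list_distinct[of ws f] NC.lincomb_list_as_mat_mult[OF dws, of "\<lambda>i. f (ws ! i)"] ws Sc
    by (simp add: N_def r_def)
  have surj: "\<exists>y\<in>carrier_vec r. N *\<^sub>v y = x" if "x \<in> mat_kernel ?A" for x
  proof -
    have "x \<in> NC.span S" using that S(2) span_same[OF SK] by (simp add: Ker.basis_def)
    then obtain f where "x = NC.lincomb f S" using NC.finite_span[OF S(1) Sc] by auto
    then show ?thesis using lc by (metis vec_carrier)
  qed
  \<comment> \<open>Linear independence is stated for coefficients attached to vectors; as
    \<open>ws\<close> is distinct, the entries of \<open>y\<close> can be reattached to the vectors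
    themselves.\<close>
  have inj: "y = 0\<^sub>v r" if y: "y \<in> carrier_vec r" and z: "N *\<^sub>v y = 0\<^sub>v n" for y
  proof -
    have injws: "inj_on ((!) ws) {..<r}" using ws(2) by (auto simp: r_def inj_on_nth)
    define f where "f = (\<lambda>w. y $ (the_inv_into {..<r} ((!) ws) w))"
    have f: "f (ws ! i) = y $ i" if "i < r" for i
      using that by (simp add: f_def the_inv_into_f_f[OF injws])
    have "vec r (\<lambda>i. f (ws ! i)) = y" using y f by auto
    then have "NC.lincomb f S = 0\<^sub>v n" using lc[of f] z by simp
    moreover have "\<not> NC.lin_dep S" using S(2) lindep_same[OF SK] by (simp add: Ker.basis_def)
    ultimately have "f w = 0" if "w \<in> S" for w
      using NC.not_lindepD[of S S f] S(1) that by auto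
    then show ?thesis using f ws y by (intro eq_vecI) (auto simp: r_def)
  qed
  \<comment> \<open>Idempotence puts the image of \<open>e\<close> into the fixed space, so every
    column of \<open>e\<close> has coordinates in the chosen basis.\<close>
  have eK: "e *\<^sub>v x \<in> mat_kernel ?A" if "x \<in> carrier_vec n" for x
    using that e ee by (auto simp: ker[symmetric] assoc_mult_mat_vec[of e n n e n x, symmetric])
  have "\<exists>y. y \<in> carrier_vec r \<and> N *\<^sub>v y = e *\<^sub>v unit_vec n j" for j
    using surj[OF eK[of "unit_vec n j"]] by auto
  then obtain c where c: "\<And>j. c j \<in> carrier_vec r \<and> N *\<^sub>v c j = e *\<^sub>v unit_vec n j" by metis
  define C where "C = mat_of_cols r (map c [0..<n])"
  have C: "C \<in> carrier_mat r n" using mat_of_cols_carrier(1)[of r "map c [0..<n]"] by (simp add: C_def)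
  have colC: "col C j = c j" if "j < n" for j using that c by (simp add: C_def)
  have NC: "N * C = e"
  proof (rule mat_col_eqI)
    fix j assume "j < dim_col e"
    then have j: "j < n" using e by simp
    have "col (N * C) j = e *\<^sub>v unit_vec n j" using col_mult2[OF N C j] colC[OF j] c by simp
    also have "\<dots> = col e j"
    proof (rule eq_vecI)
      fix i assume "i < dim_vec (col e j)"
      then have "i < n" using e by simp
      then show "(e *\<^sub>v unit_vec n j) $ i = col e j $ i"
        using mult_unit_vec_index[OF e _ j] e j by (simp del: index_mult_mat_vec)
    qed (use e in simp)
    finally show "col (N * C) j = col e j" .
  qed (use N C e in auto)
  have eN: "e * N = N"
  proof (rule mat_col_eqI)
    fix j assume "j < dim_col N"
    then have j: "j < r" using N by simp
    have "ws ! j \<in> mat_kernel ?A" using SK ws j by (auto simp: r_def)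
    then show "col (e * N) j = col N j" using col_mult2[OF e N j] colN[OF j] by (simp add: ker[symmetric])
  qed (use N e in auto)
  have CN: "C * N = 1\<^sub>m r"
  proof (rule mat_col_eqI)
    fix j assume "j < dim_col (1\<^sub>m r)"
    then have j: "j < r" by simp
    let ?x = "col (C * N) j - unit_vec r j"
    \<comment> \<open>Hence \<open>N\<close> maps column \<open>j\<close> of C N and unit vector
      \<open>j\<close> to the same vector, and injectivity of \<open>N\<close> equates them.\<close>
    have "N * (C * N) = N" using assoc_mult_mat[OF N C N] NC eN by simp
    then have "N *\<^sub>v col (C * N) j = col N j" using col_mult2[OF N mult_carrier_mat[OF C N] j] by simp
    moreover have "N *\<^sub>v unit_vec r j = col N j"
    proof (rule eq_vecI)
      fix i assume "i < dim_vec (col N j)"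
      then have "i < n" using N by simp
      then show "(N *\<^sub>v unit_vec r j) $ i = col N j $ i"
        using mult_unit_vec_index[OF N _ j] N j by (simp del: index_mult_mat_vec)
    qed (use N in simp)
    moreover have colc: "col (C * N) j \<in> carrier_vec r" by (rule carrier_vecI) (use C in simp)
    moreover have "N *\<^sub>v ?x = N *\<^sub>v col (C * N) j - N *\<^sub>v unit_vec r j"
      by (rule mult_minus_distrib_mat_vec[OF N colc]) simp
    moreover have "col N j \<in> carrier_vec n" by (rule carrier_vecI) (use N in simp)
    ultimately have "N *\<^sub>v ?x = 0\<^sub>v n" by simp
    then have x: "?x = 0\<^sub>v r" by (rule inj[rotated]) (use colc in simp)
    show "col (C * N) j = col (1\<^sub>m r) j"
    proof (rule eq_vecI)
      fix i assume "i < dim_vec (col (1\<^sub>m r) j)"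
      then have i: "i < r" by simp
      have "?x $ i = 0" unfolding x using i by simp
      then show "col (C * N) j $ i = col (1\<^sub>m r) j $ i"
        using i j by (simp del: index_col index_mult_mat)
    qed (use C in auto)
  qed (use C N in auto)
  have "mtrace e = of_nat r" using mtrace_mult_commute[OF N C] NC CN by simp
  then show ?thesis unfolding ker using dim by simp
qed

text \<open>The average \<open>e\<close> of all \<open>\<rho> g\<close> is idempotent and its fixed
  vectors are exactly the invariants, so their dimension is the trace of \<open>e\<close>, the mean
  of the character.\<close>

lemma inv_dim_character:
  assumes G: "finite_subgroup_SL3 G" and r: "is_rep G n \<rho>"
  shows "of_nat (inv_dim G n \<rho>) * of_nat (card G) = (\<Sum>g\<in>G. mtrace (\<rho> g))"
proof -
  have rc: "\<rho> g \<in> carrier_mat n n" if "g \<in> G" for g using r that by (auto simp: is_rep_def)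
  have card: "of_nat (card G) \<noteq> (0 :: complex)"
    using group_finite[OF G] group_one[OF G] by (auto simp: card_eq_0_iff)
  define e where "e = mat n n (\<lambda>(i, j). (\<Sum>g\<in>G. \<rho> g $$ (i, j)) / of_nat (card G))"
  have e: "e \<in> carrier_mat n n" by (simp add: e_def)
  have he: "\<rho> h * e = e" if h: "h \<in> G" for h
  proof (rule eq_matI)
    fix i j assume "i < dim_row e" "j < dim_col e"
    then have ij: "i < n" "j < n" using e by auto
    have "(\<rho> h * e) $$ (i, j) = (\<Sum>p<n. \<rho> h $$ (i, p) * ((\<Sum>g\<in>G. \<rho> g $$ (p, j)) / of_nat (card G)))"
      using ij by (simp add: mult_mat_entry[OF rc[OF h] e ij] del: index_mult_mat(1)) (simp add: e_def)
    also have "\<dots> = (\<Sum>g\<in>G. \<Sum>p<n. \<rho> h $$ (i, p) * \<rho> g $$ (p, j)) / of_nat (card G)"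
      by (subst sum.swap) (simp add: sum_distrib_left sum_divide_distrib)
    also have "(\<Sum>g\<in>G. \<Sum>p<n. \<rho> h $$ (i, p) * \<rho> g $$ (p, j)) = (\<Sum>g\<in>G. \<rho> (h * g) $$ (i, j))"
    proof (intro sum.cong refl)
      fix g assume g: "g \<in> G"
      have "\<rho> (h * g) = \<rho> h * \<rho> g" using r g h by (simp add: is_rep_def)
      then show "(\<Sum>p<n. \<rho> h $$ (i, p) * \<rho> g $$ (p, j)) = \<rho> (h * g) $$ (i, j)"
        by (simp add: mult_mat_entry[OF rc[OF h] rc[OF g] ij] del: index_mult_mat(1))
    qed
    also have "\<dots> = (\<Sum>g\<in>G. \<rho> g $$ (i, j))" by (rule sum_group_translate[OF G h])
    finally show "(\<rho> h * e) $$ (i, j) = e $$ (i, j)" using ij by (simp add: e_def)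
  qed (use e rc[OF h] in auto)
  have ex: "e *\<^sub>v x = x" if x: "x \<in> carrier_vec n" and inv: "\<forall>g\<in>G. \<rho> g *\<^sub>v x = x" for x
  proof (rule eq_vecI)
    fix i assume "i < dim_vec x"
    then have i: "i < n" using x by simp
    have mv: "(M *\<^sub>v x) $ i = (\<Sum>p<n. M $$ (i, p) * x $ p)" if "M \<in> carrier_mat n n" for M
      using that x i by (simp add: scalar_prod_def atLeast0LessThan)
    have "(e *\<^sub>v x) $ i = (\<Sum>p<n. (\<Sum>g\<in>G. \<rho> g $$ (i, p)) / of_nat (card G) * x $ p)"
      unfolding mv[OF e] using i by (simp add: e_def)
    also have "\<dots> = (\<Sum>g\<in>G. \<Sum>p<n. \<rho> g $$ (i, p) * x $ p) / of_nat (card G)"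
      by (subst sum.swap) (simp add: sum_distrib_right sum_divide_distrib)
    also have "(\<Sum>g\<in>G. \<Sum>p<n. \<rho> g $$ (i, p) * x $ p) = (\<Sum>g\<in>G. x $ i)"
      using inv by (intro sum.cong refl) (simp add: mv[OF rc, symmetric] del: index_mult_mat_vec)
    also have "\<dots> / of_nat (card G) = x $ i" using card by simp
    finally show "(e *\<^sub>v x) $ i = x $ i" .
  qed (use e x in auto)
  have "invariants G n \<rho> = {x \<in> carrier_vec n. e *\<^sub>v x = x}"
  proof -
    have "\<rho> g *\<^sub>v x = x" if "g \<in> G" "x \<in> carrier_vec n" "e *\<^sub>v x = x" for g x
      using assoc_mult_mat_vec[OF rc[OF that(1)] e that(2)] he[OF that(1)] that(3) by simp
    then show ?thesis using ex by (auto simp: invariants_def)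
  qed
  \<comment> \<open>Every column of \<open>e\<close> is invariant, because \<rho>(g) e = e, and
    \<open>e\<close> fixes invariant vectors.\<close>
  moreover have "e * e = e"
  proof (rule mat_col_eqI)
    fix j assume "j < dim_col e"
    then have j: "j < n" using e by simp
    have "\<rho> g *\<^sub>v col e j = col e j" if "g \<in> G" for g
      using col_mult2[OF rc[OF that] e j] he[OF that] by simp
    moreover have "col e j \<in> carrier_vec n" by (rule carrier_vecI) (use e in simp)
    ultimately show "col (e * e) j = col e j" using col_mult2[OF e e j] ex[of "col e j"] by simp
  qed (use e in auto)
  ultimately have "of_nat (inv_dim G n \<rho>) = mtrace e"
    using idempotent_trace[OF e] by (simp add: inv_dim_def)
  also have "\<dots> = (\<Sum>g\<in>G. mtrace (\<rho> g)) / of_nat (card G)"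
  proof -
    have "mtrace e = (\<Sum>i<n. \<Sum>g\<in>G. \<rho> g $$ (i, i)) / of_nat (card G)"
      by (simp add: mtrace_def e_def sum_divide_distrib)
    also have "(\<Sum>i<n. \<Sum>g\<in>G. \<rho> g $$ (i, i)) = (\<Sum>g\<in>G. mtrace (\<rho> g))"
      by (subst sum.swap) (auto simp: mtrace_def carrier_matD[OF rc] intro!: sum.cong)
    finally show ?thesis .
  qed
  finally show ?thesis using card by simp
qed

subsection \<open>The Poincare series\<close>

text \<open>Embeds integer power series coefficientwise into complex ones, where they can be
  multiplied by character values.\<close>

definition cfps :: "int fps \<Rightarrow> complex fps" where
  "cfps f = Abs_fps (\<lambda>n. of_int (fps_nth f n))"

lemma cfps_nth [simp]: "fps_nth (cfps f) n = of_int (fps_nth f n)"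
  by (simp add: cfps_def)

lemma cfps_simps:
  "cfps (f + g) = cfps f + cfps g" "cfps (f - g) = cfps f - cfps g" "cfps (f * g) = cfps f * cfps g"
  "cfps 0 = 0" "cfps 1 = 1" "cfps fps_X = fps_X" "cfps (of_nat n) = of_nat n"
  by (auto simp: fps_eq_iff fps_mult_nth fps_X_def fps_nth_of_nat)

lemma cfps_power: "cfps (f ^ n) = cfps f ^ n"
  by (induction n) (simp_all add: cfps_simps)

lemma cfps_sum: "cfps (\<Sum>i\<in>A. f i) = (\<Sum>i\<in>A. cfps (f i))"
  by (induction A rule: infinite_finite_induct) (simp_all add: cfps_simps)

lemma PG_equation:
  assumes G: "finite_subgroup_SL3 G"
    and irr: "irr_list G l d gam"
    and B: "\<forall>j\<le>l. decomposes G (d j * 3) (\<lambda>g. kron (gam j g) g) l d gam (\<lambda>i. B i j)"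
    and Bs: "\<forall>j\<le>l. decomposes G (d j * 3) (\<lambda>g. kron (gam j g) (dual3 g)) l d gam (\<lambda>i. Bs i j)"
    and v: "\<forall>m. decomposes G (sym_dim m) (sym_rep m) l d gam (v m)"
    and k: "k \<le> l"
  shows "(\<Sum>j\<le>l. Mt B Bs k j * PG v j) = (if k = 0 then 1 else 0)"
proof (rule fps_ext)
  fix n
  \<comment> \<open>\<open>F i\<close> is the defect of equation \<open>i\<close>. For fixed
    \<open>n\<close>, the coefficients of all the defects form a linear relation between irreducible
    characters, which must be trivial.\<close>
  define F where "F = (\<lambda>i. (\<Sum>j\<le>l. Mt B Bs i j * PG v j) - (if i = 0 then 1 else 0))"
  have main: "(\<Sum>i\<le>l. of_int (fps_nth (F i) n) * mtrace (gam i g)) = 0" if g: "g \<in> G" for g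
  proof -
    have gc: "g \<in> carrier_mat 3 3" "det g = 1" using G g by (auto simp: finite_subgroup_SL3_def)
    have hc: "ginv g \<in> carrier_mat 3 3" by (rule group_carrier[OF G ginv(1)[OF G g]])
    have gamc: "gam i g \<in> carrier_mat (d i) (d i)" if "i \<le> l" for i
      using irr that g by (auto simp: irr_list_def irreducible_rep_def is_rep_def)
    let ?\<chi> = "\<lambda>i. fps_const (mtrace (gam i g))"
    have dual: "dual3 g \<in> carrier_mat 3 3" "mtrace (dual3 g) = mtrace (ginv g)"
      using hc by (auto simp: dual3_def ginv_def[symmetric] mtrace_def)
    have kc: "kron (gam j g) A \<in> carrier_mat (d j * 3) (d j * 3)" if "j \<le> l" "A \<in> carrier_mat 3 3" for j A
      using gamc[OF that(1)] that(2) by (auto simp: kron_def)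
    \<comment> \<open>Taking the character of the tensor product in two ways shows that the row of
      characters is a left eigenvector of \<open>B\<close>.\<close>
    have Bg: "(\<Sum>i\<le>l. ?\<chi> i * of_nat (B i j)) = ?\<chi> j * fps_const (mtrace g)" if "j \<le> l" for j
    proof -
      have "mtrace (gam j g) * mtrace g = (\<Sum>i\<le>l. of_nat (B i j) * mtrace (gam i g))"
        using decomposes_character[OF irr B[rule_format, OF that] g kc[OF that gc(1)]]
        by (simp add: mtrace_kron[OF gamc[OF that] gc(1)])
      then show ?thesis
        by (simp add: fps_eq_iff fps_sum_nth fps_of_nat[symmetric] mult.commute del: fps_const_mult fps_of_nat)
    qed
    have Bsg: "(\<Sum>i\<le>l. ?\<chi> i * of_nat (Bs i j)) = ?\<chi> j * fps_const (mtrace (ginv g))" if "j \<le> l" for j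
    proof -
      have "mtrace (gam j g) * mtrace (ginv g) = (\<Sum>i\<le>l. of_nat (Bs i j) * mtrace (gam i g))"
        using decomposes_character[OF irr Bs[rule_format, OF that] g kc[OF that dual(1)]]
        by (simp add: mtrace_kron[OF gamc[OF that] dual(1)] dual(2))
      then show ?thesis
        by (simp add: fps_eq_iff fps_sum_nth fps_of_nat[symmetric] mult.commute del: fps_const_mult fps_of_nat)
    qed
    let ?D = "1 - fps_const (mtrace g) * fps_X + fps_const (mtrace (ginv g)) * fps_X ^ 2 - fps_X ^ 3"
    \<comment> \<open>Consequently the same row is a left eigenvector of M(t), with eigenvalue the
      inverse of the generating function of the traces on symmetric powers.\<close>
    have col: "(\<Sum>i\<le>l. ?\<chi> i * cfps (Mt B Bs i j)) = ?D * ?\<chi> j" if j: "j \<le> l" for j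
    proof -
      have "(\<Sum>i\<le>l. ?\<chi> i * cfps (Mt B Bs i j)) = (\<Sum>i\<le>l. (if i = j then ?\<chi> j * (1 - fps_X ^ 3) else 0)
          - fps_X * (?\<chi> i * of_nat (B i j)) + fps_X ^ 2 * (?\<chi> i * of_nat (Bs i j)))"
        by (intro sum.cong refl) (simp add: Mt_def cfps_simps cfps_power algebra_simps)
      also have "\<dots> = ?\<chi> j * (1 - fps_X ^ 3) - fps_X * (\<Sum>i\<le>l. ?\<chi> i * of_nat (B i j))
          + fps_X ^ 2 * (\<Sum>i\<le>l. ?\<chi> i * of_nat (Bs i j))"
        using j by (simp add: sum.distrib sum_subtractf sum_distrib_left)
      also have "\<dots> = ?D * ?\<chi> j"
        unfolding Bg[OF j] Bsg[OF j] by (simp add: algebra_simps del: fps_const_mult)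
      finally show ?thesis .
    qed
    have "(\<Sum>i\<le>l. ?\<chi> i * (\<Sum>j\<le>l. cfps (Mt B Bs i j) * cfps (PG v j)))
        = (\<Sum>j\<le>l. (\<Sum>i\<le>l. ?\<chi> i * cfps (Mt B Bs i j)) * cfps (PG v j))"
      by (simp add: sum_distrib_left sum_distrib_right mult.assoc) (rule sum.swap)
    also have "\<dots> = ?D * (\<Sum>j\<le>l. ?\<chi> j * cfps (PG v j))"
      by (simp add: col sum_distrib_left mult.assoc)
    also have "(\<Sum>j\<le>l. ?\<chi> j * cfps (PG v j)) = Abs_fps (\<lambda>m. mtrace (sym_rep m g))"
    proof (rule fps_ext)
      fix m
      have "mtrace (sym_rep m g) = (\<Sum>i\<le>l. of_nat (v m i) * mtrace (gam i g))"
        by (rule decomposes_character[OF irr v[rule_format] g sym_rep_carrier])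
      then show "fps_nth (\<Sum>j\<le>l. ?\<chi> j * cfps (PG v j)) m = fps_nth (Abs_fps (\<lambda>m. mtrace (sym_rep m g))) m"
        by (simp add: fps_sum_nth PG_def mult.commute)
    qed
    also have "?D * \<dots> = 1"
      by (rule sym_character_fps[OF gc(1) hc ginv(2)[OF G g] gc(2)])
    finally have one: "(\<Sum>i\<le>l. ?\<chi> i * (\<Sum>j\<le>l. cfps (Mt B Bs i j) * cfps (PG v j))) = 1" .
    have "(\<Sum>i\<le>l. ?\<chi> i * cfps (F i))
        = (\<Sum>i\<le>l. ?\<chi> i * (\<Sum>j\<le>l. cfps (Mt B Bs i j) * cfps (PG v j))) - (\<Sum>i\<le>l. if i = 0 then ?\<chi> 0 else 0)"
      unfolding sum_subtractf[symmetric]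
      by (intro sum.cong refl) (simp add: F_def cfps_simps cfps_sum right_diff_distrib)
    also have "\<dots> = 0" unfolding one using trivial_character[OF irr g] by simp
    finally have "fps_nth (\<Sum>i\<le>l. ?\<chi> i * cfps (F i)) n = 0" by simp
    then show ?thesis by (simp add: fps_sum_nth mult.commute)
  qed
  have "complex_of_int (fps_nth (F k) n) = 0"
    by (rule irr_characters_independent[OF G irr k main])
  then show "fps_nth (\<Sum>j\<le>l. Mt B Bs k j * PG v j) n = fps_nth (if k = 0 then 1 else 0) n"
    by (simp add: F_def)
qed

section \<open>Coefficient comparison, Cramer's rule and invertibility of the determinant\<close>

lemma fps_nth_Mt_PG:
  "fps_nth (Mt B Bs i j * PG v j) n =
     (if i = j then vext v (int n) j - vext v (int n - 3) j else 0)
     - int (B i j) * vext v (int n - 1) j + int (Bs i j) * vext v (int n - 2) j"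
proof -
  \<comment> \<open>For n < k the integer index is negative, and the value 0 of \<open>vext\<close>
    there matches the vanishing coefficient.\<close>
  have X: "fps_nth (fps_X ^ k * PG v j) n = vext v (int n - int k) j" for k
    by (auto simp: fps_X_power_mult_nth PG_def vext_def nat_diff_distrib')
  have eq: "Mt B Bs i j * PG v j = (if i = j then fps_X ^ 0 * PG v j - fps_X ^ 3 * PG v j else 0)
      - fps_const (int (B i j)) * (fps_X ^ 1 * PG v j) + fps_const (int (Bs i j)) * (fps_X ^ 2 * PG v j)"
    by (simp add: Mt_def algebra_simps fps_of_nat)
  show ?thesis unfolding eq by (simp add: X X[of 0, simplified] del: power_one_right One_nat_def)
qed

text \<open>Replacing the first column of the identity by the solution gives \<open>N\<close> with
  determinant \<open>p 0\<close>, while M N is \<open>M\<close> with its first column replaced by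
  the right side. Multiplicativity of the determinant finishes, without division.\<close>

lemma cramer_first_column:
  fixes M :: "'a :: comm_ring_1 mat"
  assumes M: "M \<in> carrier_mat (Suc l) (Suc l)"
    and sol: "\<And>i. i \<le> l \<Longrightarrow> (\<Sum>j\<le>l. M $$ (i, j) * p j) = b i"
  shows "p 0 * det M = det (mat (Suc l) (Suc l) (\<lambda>(i, j). if j = 0 then b i else M $$ (i, j)))"
proof -
  define N where "N = mat (Suc l) (Suc l) (\<lambda>(i, j). if j = 0 then p i else if i = j then 1 else (0 :: 'a))"
  have N: "N \<in> carrier_mat (Suc l) (Suc l)" by (simp add: N_def)
  have "det N = prod_list (diag_mat N)"
    by (rule det_lower_triangular[OF _ N]) (simp add: N_def)
  also have "diag_mat N = p 0 # map (\<lambda>_. 1) [1..<Suc l]"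
    unfolding diag_mat_def using N by (simp add: upt_conv_Cons N_def del: upt_Suc)
  also have "prod_list \<dots> = p 0" by (simp add: map_replicate_const del: upt_Suc)
  finally have dN: "det N = p 0" .
  have "M * N = mat (Suc l) (Suc l) (\<lambda>(i, j). if j = 0 then b i else M $$ (i, j))"
  proof (rule eq_matI)
    fix i j assume "i < dim_row (mat (Suc l) (Suc l) (\<lambda>(i, j). if j = 0 then b i else M $$ (i, j)))"
      "j < dim_col (mat (Suc l) (Suc l) (\<lambda>(i, j). if j = 0 then b i else M $$ (i, j)))"
    then have ij: "i < Suc l" "j < Suc l" by simp_all
    have MN: "(M * N) $$ (i, j) = (\<Sum>k\<le>l. M $$ (i, k) * N $$ (k, j))"
      using M N ij by (simp add: scalar_prod_def atLeast0LessThan lessThan_Suc_atMost)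
    show "(M * N) $$ (i, j) = mat (Suc l) (Suc l) (\<lambda>(i, j). if j = 0 then b i else M $$ (i, j)) $$ (i, j)"
    proof (cases "j = 0")
      case True
      then show ?thesis using sol[of i] ij unfolding MN by (simp add: N_def less_Suc_eq_le)
    next
      case False
      have "(\<Sum>k\<le>l. M $$ (i, k) * N $$ (k, j)) = (\<Sum>k\<le>l. if k = j then M $$ (i, j) else 0)"
        using False ij by (intro sum.cong refl) (auto simp: N_def)
      then show ?thesis using False ij unfolding MN by simp
    qed
  qed (use M N in auto)
  then show ?thesis using det_mult[OF M N] dN by (simp add: mult.commute)
qed

text \<open>Taking constant coefficients is a ring homomorphism and commutes with determinants, so
  the constant coefficient of the determinant is that of the identity, namely 1.\<close>

lemma fps_det_invertible:
  fixes M :: "int fps mat"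
  assumes M: "M \<in> carrier_mat n n"
    and id: "\<And>i j. i < n \<Longrightarrow> j < n \<Longrightarrow> fps_nth (M $$ (i, j)) 0 = (if i = j then 1 else 0)"
  shows "\<exists>u. det M * u = 1"
proof -
  interpret h: comm_ring_hom "\<lambda>f :: int fps. fps_nth f 0"
    by unfold_locales simp_all
  have "map_mat (\<lambda>f. fps_nth f 0) M = 1\<^sub>m n" using M id by (intro eq_matI) auto
  then have "fps_nth (det M) 0 = 1" using h.hom_det[of M] by simp
  then have "det M * fps_right_inverse (det M) 1 = 1" by (intro fps_right_inverse) simp
  then show ?thesis by blast
qed

text \<open>The trivial character is constantly 1, so pairing with it computes the plain sum of the
  character over the group, which also counts invariants.\<close>

lemma trivial_multiplicity_eq_inv_dim:
  assumes G: "finite_subgroup_SL3 G" and irr: "irr_list G l d gam"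
    and r: "is_rep G n \<rho>" and dec: "decomposes G n \<rho> l d gam c"
  shows "c 0 = inv_dim G n \<rho>"
proof -
  have "(\<Sum>g\<in>G. mtrace (\<rho> g)) = (\<Sum>g\<in>G. (\<Sum>i\<le>l. of_nat (c i) * mtrace (gam i g)) * mtrace (gam 0 (ginv g)))"
    using r by (intro sum.cong refl)
      (simp add: decomposes_character[OF irr dec] is_rep_def trivial_character[OF irr] ginv[OF G])
  also have "\<dots> = of_nat (c 0) * of_nat (card G)"
    by (rule irr_character_multiplicity[OF G irr]) simp
  finally have "of_nat (inv_dim G n \<rho>) * of_nat (card G) = (of_nat (c 0) * of_nat (card G) :: complex)"
    using inv_dim_character[OF G r] by simp
  moreover have "card G \<noteq> 0"
    using group_finite[OF G] group_one[OF G] by (auto simp: card_eq_0_iff)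
  ultimately show ?thesis by simp
qed

text \<open>The quotient in (c) is expressed as a product with the determinant of M(t), together
  with the statement that this determinant is a unit.\<close>

theorem theorem2:
  fixes G :: "complex mat set" and l :: nat and d :: "nat \<Rightarrow> nat"
    and gam :: "nat \<Rightarrow> complex mat \<Rightarrow> complex mat"
    and B Bs :: "nat \<Rightarrow> nat \<Rightarrow> nat" and v :: "nat \<Rightarrow> nat \<Rightarrow> nat"
  assumes G: "finite_subgroup_SL3 G"
    and irr: "irr_list G l d gam"
    and B: "\<forall>j\<le>l. decomposes G (d j * 3) (\<lambda>g. kron (gam j g) g) l d gam (\<lambda>i. B i j)"
    and Bs: "\<forall>j\<le>l. decomposes G (d j * 3) (\<lambda>g. kron (gam j g) (dual3 g)) l d gam (\<lambda>i. Bs i j)"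
    and v: "\<forall>m. decomposes G (sym_dim m) (sym_rep m) l d gam (v m)"
  shows "(\<forall>m::int. m \<ge> -1 \<longrightarrow> (\<forall>i\<le>l.
            vext v (m + 2) i = (\<Sum>j\<le>l. int (B i j) * vext v (m + 1) j)
                              - (\<Sum>j\<le>l. int (Bs i j) * vext v m j) + vext v (m - 1) i))
       \<and> (\<forall>i\<le>l. (\<Sum>j\<le>l. Mt B Bs i j * PG v j) = (if i = 0 then 1 else 0))
       \<and> (\<exists>u :: int fps. det (M_mat l B Bs) * u = 1)
       \<and> (\<forall>m. v m 0 = inv_dim G (sym_dim m) (sym_rep m))
       \<and> PG v 0 * det (M_mat l B Bs) = det (M0_mat l B Bs)"
proof (intro conjI allI impI)
  note eqn = PG_equation[OF G irr B Bs v]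
  show "(\<Sum>j\<le>l. Mt B Bs i j * PG v j) = (if i = 0 then 1 else 0)" if "i \<le> l" for i
    by (rule eqn[OF that])
  show "vext v (m + 2) i = (\<Sum>j\<le>l. int (B i j) * vext v (m + 1) j)
      - (\<Sum>j\<le>l. int (Bs i j) * vext v m j) + vext v (m - 1) i" if m: "m \<ge> -1" and i: "i \<le> l" for m i
  proof -
    \<comment> \<open>The bound m \<ge> -1 gives n \<ge> 1, where the constant series on the right
      of (b) has coefficient 0.\<close>
    define n where "n = nat (m + 2)"
    have n: "int n = m + 2" "n \<noteq> 0" and n': "int n - 3 = m - 1" "int n - 2 = m" "int n - 1 = m + 1"
      using m by (auto simp: n_def)
    have "0 = fps_nth (\<Sum>j\<le>l. Mt B Bs i j * PG v j) n" unfolding eqn[OF i] using n by simp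
    also have "\<dots> = (\<Sum>j\<le>l. (if i = j then vext v (m + 2) j - vext v (m - 1) j else 0)
        - int (B i j) * vext v (m + 1) j + int (Bs i j) * vext v m j)"
      by (simp only: fps_sum_nth fps_nth_Mt_PG n') (simp only: n(1))
    also have "\<dots> = vext v (m + 2) i - vext v (m - 1) i - (\<Sum>j\<le>l. int (B i j) * vext v (m + 1) j)
        + (\<Sum>j\<le>l. int (Bs i j) * vext v m j)"
      using i by (simp add: sum.distrib sum_subtractf)
    finally show ?thesis by simp
  qed
  show "\<exists>u. det (M_mat l B Bs) * u = 1"
    by (rule fps_det_invertible[of _ "Suc l"]) (auto simp: M_mat_def Mt_def)
  show "v m 0 = inv_dim G (sym_dim m) (sym_rep m)" for m
  proof (rule trivial_multiplicity_eq_inv_dim[OF G irr _ v[rule_format]])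
    show "is_rep G (sym_dim m) (sym_rep m)"
      using sym_rep_carrier sym_rep_one sym_rep_mult group_carrier[OF G] by (simp add: is_rep_def)
  qed
  \<comment> \<open>Cramer's rule applies to (b), whose right side is exactly the column inserted in
    M_0(t).\<close>
  have "PG v 0 * det (M_mat l B Bs) = det (mat (Suc l) (Suc l)
      (\<lambda>(i, j). if j = 0 then if i = 0 then 1 else 0 else M_mat l B Bs $$ (i, j)))"
    by (rule cramer_first_column) (simp_all add: M_mat_def eqn less_Suc_eq_le)
  also have "mat (Suc l) (Suc l) (\<lambda>(i, j). if j = 0 then if i = 0 then 1 else 0 else M_mat l B Bs $$ (i, j))
      = M0_mat l B Bs"
    by (rule eq_matI) (auto simp: M_mat_def M0_mat_def)
  finally show "PG v 0 * det (M_mat l B Bs) = det (M0_mat l B Bs)" .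
qed

end
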